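(* Let $\mathbb{G}$ be a homogeneous Lie group of homogeneous dimension $Q$. Let $0<\lambda<Q$, $0<\alpha\leq1$ and $1<p\leq\infty$ with $\alpha=\lambda-Q/p$. Let $K$ be a kernel of type $\lambda$ on $\mathbb{G}$. Then, for the mapping $T:f\mapsto f\ast K$, we have $$|Tf|_{\alpha}\leq C\|f\|_{L^{p}(\mathbb{G})}$$ for $f\in L^p(\mathbb{G})$, with a constant $C$ independent of $f$.
   Context: A homogeneous Lie group is a connected simply connected (nilpotent) Lie group $\mathbb{G}$ whose Lie algebra $\mathfrak{g}$ is equipped with a family of dilations $D_r=\mathrm{Exp}(A\ln r)$, $r>0$, where $A$ is a diagonalisable linear operator on $\mathfrak{g}$ with positive eigenvalues and each $D_r$ is a morphism of the Lie algebra. Via the exponential map, in a suitable basis, $\mathbb{G}$ is identified with $\mathbb{R}^n$ and the dilations become $D_r(x)=rx=(r^{\nu_1}x_1,\dots,r^{\nu_n}x_n)$, where $\nu_1,\dots,\nu_n$ are the weights (the eigenvalues of $A$). The homogeneous dimension is $Q=\nu_1+\dots+\nu_n$, and Lebesgue measure $dx$ is a (bi-invariant) Haar measure. Fix a homogeneous quasi-norm $|\cdot|$: a continuous function $\mathbb{G}\to[0,\infty)$ with $|x^{-1}|=|x|$, $|rx|=r|x|$ for $r>0$, and $|x|=0$ iff $x=0$. A kernel of type $\lambda$ is a distribution on $\mathbb{G}$ that is smooth away from the origin and homogeneous of degree $\lambda-Q$, where a distribution $\tau$ is homogeneous of degree $\mu$ if $\langle\tau,\phi\circ D_r\rangle=r^{-Q-\mu}\langle\tau,\phi\rangle$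 for all test functions $\phi$ and all $r>0$. Convolution: $(f\ast K)(x)=\int_{\mathbb{G}}f(xz^{-1})K(z)\,dz$. Lipschitz seminorms: for $0<\alpha<1$, $|g|_{\alpha}=\sup_{x,y}|g(xy)-g(x)|/|y|^{\alpha}$; for $\alpha=1$, $|g|_{1}=\sup_{x,y}|g(xy)+g(xy^{-1})-2g(x)|/|y|$.
   Formalization: Weights are assumed to satisfy α < ν_i for all i (1 < 2ν_i if α = 1), without which the claim fails for nonzero K; where the integral f∗K diverges, Tf is understood through its first (second, if α = 1) differences taken under the integral sign. *)

theory Defs
  imports "HOL-Probability.Essential_Supremum"
begin

section \<open>Smooth functions\<close>

primrec partials :: "'a::euclidean_space list \<Rightarrow> ('a \<Rightarrow> 'b::real_normed_vector) \<Rightarrow> 'a \<Rightarrow> 'b" where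
  "partials [] f = f"
| "partials (b # bs) f = (\<lambda>x. frechet_derivative (partials bs f) (at x) b)"

text \<open>Meant for open \<open>S\<close>: all iterated partial derivatives exist and are (totally) differentiable,
  hence continuous, at every point of \<open>S\<close>.\<close>

definition smooth_on :: "'a::euclidean_space set \<Rightarrow> ('a \<Rightarrow> 'b::real_normed_vector) \<Rightarrow> bool" where
  "smooth_on S f \<longleftrightarrow> (\<forall>bs. set bs \<subseteq> Basis \<longrightarrow> (\<forall>x\<in>S. partials bs f differentiable (at x)))"

section \<open>Homogeneous Lie groups\<close>

definition dil :: "('n::finite \<Rightarrow> real) \<Rightarrow> real \<Rightarrow> real ^ 'n \<Rightarrow> real ^ 'n" where
  "dil \<nu> r x = (\<chi> i. r powr \<nu> i * x $ i)"

definition hom_dim :: "('n::finite \<Rightarrow> real) \<Rightarrow> real" where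
  "hom_dim \<nu> = (\<Sum>i\<in>UNIV. \<nu> i)"

text \<open>A homogeneous Lie group identified with its Lie algebra by the exponential map, in a basis of
  eigenvectors of the generator of the dilations. That the chart is exponential is \<open>one_param\<close>:
  the lines \<open>t \<mapsto> t x\<close> are the one-parameter subgroups; in particular the inverse of \<open>x\<close> is \<open>- x\<close>.
  The dilations are Lie algebra morphisms, that is, automorphisms of the simply connected group.\<close>

locale homogeneous_group = Groups.group mul 0 uminus
  for mul :: "real ^ 'n::finite \<Rightarrow> real ^ 'n \<Rightarrow> real ^ 'n" +
  fixes \<nu> :: "'n \<Rightarrow> real"
  assumes smooth_mul: "smooth_on UNIV (\<lambda>(x, y). mul x y)"
    and one_param: "mul (s *\<^sub>R x) (t *\<^sub>R x) = (s + t) *\<^sub>R x"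
    and weight_pos: "0 < \<nu> i"
    and dil_mul: "0 < r \<Longrightarrow> dil \<nu> r (mul x y) = mul (dil \<nu> r x) (dil \<nu> r y)"

definition homogeneous_quasi_norm :: "('n::finite \<Rightarrow> real) \<Rightarrow> (real ^ 'n \<Rightarrow> real) \<Rightarrow> bool" where
  "homogeneous_quasi_norm \<nu> N \<longleftrightarrow>
     continuous_on UNIV N \<and>
     (\<forall>x. 0 \<le> N x) \<and>
     (\<forall>x. N (- x) = N x) \<and>
     (\<forall>r x. 0 < r \<longrightarrow> N (dil \<nu> r x) = r * N x) \<and>
     (\<forall>x. N x = 0 \<longleftrightarrow> x = 0)"

section \<open>Distributions and kernels of type \<open>\<lambda>\<close>\<close>

definition supp :: "('a::topological_space \<Rightarrow> 'b::zero) \<Rightarrow> 'a set" where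
  "supp \<phi> = closure {x. \<phi> x \<noteq> 0}"

definition test_function :: "('a::euclidean_space \<Rightarrow> complex) \<Rightarrow> bool" where
  "test_function \<phi> \<longleftrightarrow> smooth_on UNIV \<phi> \<and> compact (supp \<phi>)"

definition test_null_sequence :: "(nat \<Rightarrow> 'a::euclidean_space \<Rightarrow> complex) \<Rightarrow> bool" where
  "test_null_sequence \<phi> \<longleftrightarrow>
     (\<forall>k. test_function (\<phi> k)) \<and>
     (\<exists>X. compact X \<and> (\<forall>k. supp (\<phi> k) \<subseteq> X)) \<and>
     (\<forall>bs. set bs \<subseteq> Basis \<longrightarrow>
        uniform_limit UNIV (\<lambda>k. partials bs (\<phi> k)) (\<lambda>_. 0) sequentially)"

definition distribution :: "(('a::euclidean_space \<Rightarrow> complex) \<Rightarrow> complex) \<Rightarrow> bool" where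
  "distribution \<tau> \<longleftrightarrow>
     (\<forall>\<phi> \<psi>. test_function \<phi> \<longrightarrow> test_function \<psi> \<longrightarrow> \<tau> (\<lambda>x. \<phi> x + \<psi> x) = \<tau> \<phi> + \<tau> \<psi>) \<and>
     (\<forall>c \<phi>. test_function \<phi> \<longrightarrow> \<tau> (\<lambda>x. c * \<phi> x) = c * \<tau> \<phi>) \<and>
     (\<forall>\<phi>. test_null_sequence \<phi> \<longrightarrow> (\<lambda>k. \<tau> (\<phi> k)) \<longlonglongrightarrow> 0)"

text \<open>\<open>K\<close> is the smooth function with which \<open>\<tau>\<close> coincides on the complement of the origin; the
  value \<open>K 0\<close> is arbitrary.\<close>

definition smooth_off_origin ::
    "((real ^ 'n::finite \<Rightarrow> complex) \<Rightarrow> complex) \<Rightarrow> (real ^ 'n \<Rightarrow> complex) \<Rightarrow> bool" where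
  "smooth_off_origin \<tau> K \<longleftrightarrow>
     smooth_on (- {0}) K \<and>
     (\<forall>\<phi>. test_function \<phi> \<longrightarrow> 0 \<notin> supp \<phi> \<longrightarrow> \<tau> \<phi> = (LINT x|lebesgue. K x * \<phi> x))"

definition homogeneous_distribution ::
    "('n::finite \<Rightarrow> real) \<Rightarrow> real \<Rightarrow> ((real ^ 'n \<Rightarrow> complex) \<Rightarrow> complex) \<Rightarrow> bool" where
  "homogeneous_distribution \<nu> \<mu> \<tau> \<longleftrightarrow>
     (\<forall>\<phi> r. test_function \<phi> \<longrightarrow> 0 < r \<longrightarrow>
        \<tau> (\<phi> \<circ> dil \<nu> r) = of_real (r powr (- hom_dim \<nu> - \<mu>)) * \<tau> \<phi>)"

text \<open>For \<open>\<lambda> > 0\<close> the distribution \<open>\<tau>\<close> is integration against the locally integrable function \<open>K\<close>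
  (a distribution supported at the origin is not homogeneous of degree \<open>> - Q\<close> unless it is \<open>0\<close>),
  so that convolution with \<open>\<tau>\<close> is convolution with \<open>K\<close>.\<close>

definition kernel_of_type ::
    "('n::finite \<Rightarrow> real) \<Rightarrow> real \<Rightarrow> ((real ^ 'n \<Rightarrow> complex) \<Rightarrow> complex) \<Rightarrow> (real ^ 'n \<Rightarrow> complex) \<Rightarrow> bool"
  where
  "kernel_of_type \<nu> lam \<tau> K \<longleftrightarrow>
     distribution \<tau> \<and> smooth_off_origin \<tau> K \<and> homogeneous_distribution \<nu> (lam - hom_dim \<nu>) \<tau>"

section \<open>Lebesgue spaces\<close>

definition in_Lp :: "ereal \<Rightarrow> ('a::euclidean_space \<Rightarrow> complex) \<Rightarrow> bool" where
  "in_Lp p f \<longleftrightarrow> f \<in> borel_measurable lebesgue \<and>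
     (if p = \<infinity> then esssup lebesgue (\<lambda>x. ennreal (norm (f x))) < \<infinity>
      else integrable lebesgue (\<lambda>x. norm (f x) powr real_of_ereal p))"

definition Lp_norm :: "ereal \<Rightarrow> ('a::euclidean_space \<Rightarrow> complex) \<Rightarrow> real" where
  "Lp_norm p f =
     (if p = \<infinity> then enn2real (esssup lebesgue (\<lambda>x. ennreal (norm (f x))))
      else (LINT x|lebesgue. norm (f x) powr real_of_ereal p) powr (1 / real_of_ereal p))"

section \<open>Convolution and Lipschitz seminorms\<close>

definition conv_integrable ::
    "(real ^ 'n::finite \<Rightarrow> real ^ 'n \<Rightarrow> real ^ 'n) \<Rightarrow>
     (real ^ 'n \<Rightarrow> complex) \<Rightarrow> (real ^ 'n \<Rightarrow> complex) \<Rightarrow> real ^ 'n \<Rightarrow> bool" where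
  "conv_integrable mul f K x \<longleftrightarrow> integrable lebesgue (\<lambda>z. f (mul x (- z)) * K z)"

definition conv ::
    "(real ^ 'n::finite \<Rightarrow> real ^ 'n \<Rightarrow> real ^ 'n) \<Rightarrow>
     (real ^ 'n \<Rightarrow> complex) \<Rightarrow> (real ^ 'n \<Rightarrow> complex) \<Rightarrow> real ^ 'n \<Rightarrow> complex" where
  "conv mul f K x = (LINT z|lebesgue. f (mul x (- z)) * K z)"

definition lip_diff ::
    "(real ^ 'n::finite \<Rightarrow> real ^ 'n \<Rightarrow> real ^ 'n) \<Rightarrow> real \<Rightarrow>
     (real ^ 'n \<Rightarrow> complex) \<Rightarrow> real ^ 'n \<Rightarrow> real ^ 'n \<Rightarrow> complex" where
  "lip_diff mul \<alpha> g x y =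
     (if \<alpha> = 1 then g (mul x y) + g (mul x (- y)) - 2 * g x else g (mul x y) - g x)"

text \<open>The terms with \<open>y = 0\<close> contribute \<open>0 / 0 = 0\<close>.\<close>

definition lip_sup ::
    "(real ^ 'n::finite \<Rightarrow> real) \<Rightarrow> real \<Rightarrow> (real ^ 'n \<Rightarrow> real ^ 'n \<Rightarrow> complex) \<Rightarrow> ennreal" where
  "lip_sup N \<alpha> D = (SUP x. SUP y. ennreal (norm (D x y) / N y powr \<alpha>))"

definition lip_seminorm ::
    "(real ^ 'n::finite \<Rightarrow> real ^ 'n \<Rightarrow> real ^ 'n) \<Rightarrow> (real ^ 'n \<Rightarrow> real) \<Rightarrow> real \<Rightarrow>
     (real ^ 'n \<Rightarrow> complex) \<Rightarrow> ennreal" where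
  "lip_seminorm mul N \<alpha> g = lip_sup N \<alpha> (lip_diff mul \<alpha> g)"

text \<open>For \<open>\<lambda> > Q / p\<close> the integral defining \<open>f * K\<close> need not converge at infinity for all \<open>f \<in> L\<^sup>p\<close>
  (for example for \<open>p = \<infinity>\<close>, \<open>f = 1\<close>, \<open>K > 0\<close>), and \<open>f * K\<close> is then understood through its differences,
  obtained by writing \<open>(f * K)(x)\<close> as the integral of \<open>f(w) K(w\<^sup>-\<^sup>1 x)\<close> over \<open>w\<close> and applying the
  difference operator in \<open>x\<close> under the integral sign.\<close>

definition conv_diff_integrand ::
    "(real ^ 'n::finite \<Rightarrow> real ^ 'n \<Rightarrow> real ^ 'n) \<Rightarrow> real \<Rightarrow>
     (real ^ 'n \<Rightarrow> complex) \<Rightarrow> (real ^ 'n \<Rightarrow> complex) \<Rightarrow> real ^ 'n \<Rightarrow> real ^ 'n \<Rightarrow> real ^ 'n \<Rightarrow> complex"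
  where
  "conv_diff_integrand mul \<alpha> f K x y w = f w * lip_diff mul \<alpha> (\<lambda>u. K (mul (- w) u)) x y"

definition conv_diff ::
    "(real ^ 'n::finite \<Rightarrow> real ^ 'n \<Rightarrow> real ^ 'n) \<Rightarrow> real \<Rightarrow>
     (real ^ 'n \<Rightarrow> complex) \<Rightarrow> (real ^ 'n \<Rightarrow> complex) \<Rightarrow> real ^ 'n \<Rightarrow> real ^ 'n \<Rightarrow> complex" where
  "conv_diff mul \<alpha> f K x y = (LINT w|lebesgue. conv_diff_integrand mul \<alpha> f K x y w)"

text \<open>Compatibility of the normalisation of the dilations with the order \<open>\<alpha>\<close>. It holds for every
  \<open>0 < \<alpha> \<le> 1\<close> under the usual normalisation that the smallest weight is \<open>1\<close>. Without it the
  seminorms degenerate: a function on \<open>\<real>\<^sup>2\<close> with weights \<open>1/2\<close> and \<open>10\<close> whose seminorm of order \<open>9/10\<close>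
  is finite is constant in its first variable, because it is Hoelder continuous of exponent \<open>9/5\<close>
  there, whereas \<open>f * K\<close> is not for \<open>\<lambda> = 10\<close>, \<open>p = 105/91\<close>, \<open>K > 0\<close> and a nonzero \<open>f \<ge> 0\<close>
  with compact support.\<close>

definition order_admissible :: "('n::finite \<Rightarrow> real) \<Rightarrow> real \<Rightarrow> bool" where
  "order_admissible \<nu> \<alpha> \<longleftrightarrow> (\<forall>i. \<alpha> < (if \<alpha> = 1 then 2 * \<nu> i else \<nu> i))"

end

theory Submission
  imports Defs
begin

text \<open>
  Writing \<open>(f * K)(x)\<close> as the integral of \<open>f(w) K(w\<^sup>-\<^sup>1 x)\<close> and using Hoelder's inequality, it suffices to
  bound the integral of \<open>\<bar>\<Delta>\<^sub>y K(u)\<bar>\<^sup>q\<close> over \<open>u\<close> by a multiple of \<open>N(y)\<close> to the power \<open>\<alpha> q\<close>, where \<open>\<Delta>\<^sub>y\<close> is the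
  difference operator of the seminorm and \<open>q\<close> is conjugate to \<open>p\<close>, so that \<open>Q/q = Q - \<lambda> + \<alpha>\<close>. By
  homogeneity one may take \<open>N(y) = 1\<close>. For bounded \<open>u\<close> the three terms are integrated separately, since
  \<open>\<bar>K\<bar>\<^sup>q\<close> is locally integrable (\<open>\<alpha> > 0\<close>). For large \<open>u\<close>, scaling to \<open>N(u) = 1\<close> and differentiating
  along one-parameter subgroups gains a power of \<open>N(u)\<close> larger than \<open>\<alpha>\<close>, namely the smallest weight (twice
  the smallest weight for second differences), which makes the integral converge at infinity.

  Right translations preserve Lebesgue measure because their Jacobian at \<open>(v, x)\<close> is invariant under
  simultaneous dilation of \<open>v\<close> and \<open>x\<close>, and tends to \<open>1\<close> as both are shrunk to the origin.
\<close>

section \<open>Haar measure\<close>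

text \<open>The difference operator shifts its argument on the right and so commutes with left
  translations. After the substitution \<open>u = w^-1 x\<close> the point \<open>x\<close>
  disappears from the L^q norm, and one integral in \<open>u\<close> serves all \<open>x\<close>.
  With \<open>k\<close> the order of the difference (1 or 2) and \<open>s\<close> the smallest
  weight, the powers of \<open>N\<close> to be integrated are \<open>(\<lambda> - Q) q\<close> for
  bounded \<open>u\<close> and \<open>(\<lambda> - Q - k s) q\<close> at infinity. As
  \<open>(\<lambda> - Q) q + Q = \<alpha> q\<close>, the first is integrable because
  \<open>\<alpha> > 0\<close> and the second because \<open>\<alpha> < k s\<close>, which is what
  \<open>order_admissible\<close> says. Homogeneity is given for the distribution only; it is passed
  on to the function \<open>K\<close> by testing against bump functions away from the origin. The
  roles of polar coordinates and of a quasi-triangle inequality for \<open>N\<close> are taken by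
  dyadic shells and by compactness of the sets where \<open>N \<le> R\<close>.\<close>

text \<open>Members of L^p are measurable for the completed measure only, so substitutions must be
  valid there. A map that carries \<open>lborel\<close> to itself pulls null sets back to null sets
  and hence extends to the completion.\<close>

lemma lebesgue_distr_eqI:
  fixes T :: "'a::euclidean_space \<Rightarrow> 'b::euclidean_space"
  assumes T [measurable]: "T \<in> borel_measurable borel" and eq: "distr lborel borel T = lborel"
  shows lebesgue_distr_measurable: "T \<in> lebesgue \<rightarrow>\<^sub>M lebesgue"
    and lebesgue_distr_eq: "distr lebesgue lebesgue T = lebesgue"
proof -
  have T': "T \<in> lebesgue \<rightarrow>\<^sub>M lborel"
    by (intro measurable_completion) simp
  have d: "distr lebesgue lborel T = lborel"
    using eq by (simp add: distr_completion cong: distr_cong)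
  show "T \<in> lebesgue \<rightarrow>\<^sub>M lebesgue"
    using T' d by (intro completion.measurable_completion2) auto
  show "distr lebesgue lebesgue T = lebesgue"
    using completion.completion_distr_eq[OF T'] d by simp
qed

text \<open>The change of variables theorem is available for well-ordered index types only; this copy of
  a finite type carries an arbitrary such order.\<close>

typedef 'a ordered_copy = "UNIV :: 'a set" morphisms of_copy to_copy ..

lemma of_copy_inject [simp]: "of_copy x = of_copy y \<longleftrightarrow> x = y"
  by (simp add: of_copy_inject)

lemma to_of_copy [simp]: "to_copy (of_copy x) = x" and of_to_copy [simp]: "of_copy (to_copy y) = y"
  by (simp_all add: of_copy_inverse to_copy_inverse)

lemma bij_of_copy: "bij of_copy"
  by (rule bij_betw_byWitness[where f' = to_copy]) auto

instance ordered_copy :: (finite) finite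
proof
  show "finite (UNIV :: 'a ordered_copy set)"
    using bij_betw_finite[OF bij_of_copy[where ?'a = 'a]] by simp
qed

instantiation ordered_copy :: (finite) wellorder
begin

definition less_eq_ordered_copy :: "'a ordered_copy \<Rightarrow> 'a ordered_copy \<Rightarrow> bool" where
  "less_eq_ordered_copy x y \<longleftrightarrow> to_nat (of_copy x) \<le> to_nat (of_copy y)"

definition less_ordered_copy :: "'a ordered_copy \<Rightarrow> 'a ordered_copy \<Rightarrow> bool" where
  "less_ordered_copy x y \<longleftrightarrow> to_nat (of_copy x) < to_nat (of_copy y)"

instance
proof
  fix P :: "'a ordered_copy \<Rightarrow> bool" and a
  assume step: "\<And>x. (\<And>y. y < x \<Longrightarrow> P y) \<Longrightarrow> P x"
  show "P a"
    by (induction a rule: measure_induct_rule[where f = "\<lambda>x. to_nat (of_copy x)"])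
       (auto intro: step simp: less_ordered_copy_def)
qed (auto simp: less_eq_ordered_copy_def less_ordered_copy_def)

end

definition to_copy_vec :: "real ^ 'n::finite \<Rightarrow> real ^ 'n ordered_copy" where
  "to_copy_vec x = (\<chi> i. x $ of_copy i)"

definition of_copy_vec :: "real ^ 'n::finite ordered_copy \<Rightarrow> real ^ 'n" where
  "of_copy_vec x = (\<chi> i. x $ to_copy i)"

lemma to_of_copy_vec [simp]: "to_copy_vec (of_copy_vec x) = x"
  and of_to_copy_vec [simp]: "of_copy_vec (to_copy_vec y) = y"
  by (simp_all add: to_copy_vec_def of_copy_vec_def vec_eq_iff)

lemma linear_to_copy_vec: "linear to_copy_vec" and linear_of_copy_vec: "linear of_copy_vec"
  by (auto intro!: linearI simp: to_copy_vec_def of_copy_vec_def vec_eq_iff)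

lemma measurable_to_copy_vec [measurable]: "to_copy_vec \<in> borel_measurable borel"
  and measurable_of_copy_vec [measurable]: "of_copy_vec \<in> borel_measurable borel"
  using linear_to_copy_vec linear_of_copy_vec
  by (auto intro!: borel_measurable_continuous_onI linear_continuous_on simp: linear_conv_bounded_linear)

lemma prod_Basis_vec: "(\<Prod>b\<in>(Basis :: (real ^ 'n::finite) set). g b) = (\<Prod>i\<in>UNIV. g (axis i 1))"
proof -
  have "(Basis :: (real ^ 'n) set) = (\<lambda>i. axis i 1) ` UNIV"
    by (auto simp: Basis_vec_def)
  then have "prod g Basis = prod g ((\<lambda>i. axis i 1) ` UNIV)"
    by (rule arg_cong)
  also have "\<dots> = prod (g \<circ> (\<lambda>i. axis i 1)) UNIV"
    by (rule prod.reindex) (auto simp: inj_on_def axis_eq_axis)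
  finally show ?thesis
    by (simp add: o_def)
qed

text \<open>Relabelling coordinates turns a box into a box with the same side lengths, and boxes
  determine \<open>lborel\<close>.\<close>

lemma distr_to_copy_vec: "distr lborel borel (to_copy_vec :: real ^ 'n::finite \<Rightarrow> _) = lborel"
proof (rule lborel_eqI[symmetric])
  fix l u :: "real ^ 'n ordered_copy"
  assume le: "\<And>b. b \<in> Basis \<Longrightarrow> l \<bullet> b \<le> u \<bullet> b"
  have le': "l $ i \<le> u $ i" for i
    using le[of "axis i 1"] by (simp add: inner_axis axis_in_Basis_iff)
  have vim: "to_copy_vec -` box l u = box (of_copy_vec l) (of_copy_vec u)"
  proof (intro set_eqI iffI)
    fix x :: "real ^ 'n"
    assume "x \<in> to_copy_vec -` box l u"
    then have "l $ to_copy i < x $ i \<and> x $ i < u $ to_copy i" for i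
      by (simp add: mem_box_cart to_copy_vec_def) (metis of_to_copy)
    then show "x \<in> box (of_copy_vec l) (of_copy_vec u)"
      by (simp add: mem_box_cart of_copy_vec_def)
  next
    fix x :: "real ^ 'n"
    assume "x \<in> box (of_copy_vec l) (of_copy_vec u)"
    then have "l $ i < x $ of_copy i \<and> x $ of_copy i < u $ i" for i
      by (simp add: mem_box_cart of_copy_vec_def) (metis to_of_copy)
    then show "x \<in> to_copy_vec -` box l u"
      by (simp add: mem_box_cart to_copy_vec_def)
  qed
  have "emeasure (distr lborel borel to_copy_vec) (box l u)
      = emeasure lborel (box (of_copy_vec l) (of_copy_vec u))"
    by (simp add: emeasure_distr vim)
  also have "\<dots> = ennreal (\<Prod>b\<in>Basis. (of_copy_vec u - of_copy_vec l) \<bullet> b)"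
    using le' by (intro emeasure_lborel_box) (auto simp: Basis_vec_def inner_axis of_copy_vec_def)
  also have "(\<Prod>b\<in>Basis. (of_copy_vec u - of_copy_vec l) \<bullet> b) = (\<Prod>i\<in>UNIV. (u - l) $ to_copy i)"
    by (simp add: prod_Basis_vec inner_axis of_copy_vec_def)
  also have "\<dots> = (\<Prod>i\<in>UNIV. (u - l) $ i)"
    by (rule prod.reindex_bij_witness[of _ of_copy to_copy]) auto
  also have "\<dots> = prod ((\<bullet>) (u - l)) Basis"
    by (simp add: prod_Basis_vec inner_axis)
  finally show "emeasure (distr lborel borel to_copy_vec) (box l u) = ennreal (prod ((\<bullet>) (u - l)) Basis)" .
qed simp

lemma distr_of_copy_vec: "distr lborel borel (of_copy_vec :: _ \<Rightarrow> real ^ 'n::finite) = lborel"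
proof -
  have "distr lborel borel (of_copy_vec :: _ \<Rightarrow> real ^ 'n)
      = distr (distr lborel borel to_copy_vec) borel of_copy_vec"
    by (simp add: distr_to_copy_vec)
  also have "\<dots> = distr lborel borel (of_copy_vec \<circ> to_copy_vec)"
    by (intro distr_distr) auto
  also have "\<dots> = distr lborel borel (\<lambda>x. x)"
    by (simp add: o_def)
  finally show ?thesis
    by (simp add: distr_id2)
qed

section \<open>Maps with Jacobian determinant of modulus one\<close>

text \<open>The preimage \<open>S\<close> of a box is mapped onto the box, whose measure is thus the
  integral of the Jacobian over \<open>S\<close>. As the Jacobian has modulus 1, this is the measure
  of \<open>S\<close>.\<close>

lemma distr_lborel_unimodular:
  fixes f :: "real ^ 'n::{finite,wellorder} \<Rightarrow> real ^ 'n::_"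
  assumes der: "\<And>x. (f has_derivative f' x) (at x)"
    and det: "\<And>x. \<bar>det (matrix (f' x))\<bar> = 1" and bij: "bij f"
  shows "distr lborel borel f = lborel"
proof (rule lborel_eqI[symmetric])
  have cont: "continuous_on UNIV f"
    by (intro continuous_at_imp_continuous_on ballI has_derivative_continuous[OF der])
  then have [measurable]: "f \<in> borel_measurable borel"
    by (rule borel_measurable_continuous_onI)
  fix l u :: "real ^ 'n::_"
  assume le: "\<And>b. b \<in> Basis \<Longrightarrow> l \<bullet> b \<le> u \<bullet> b"
  define S where "S = f -` box l u"
  define m where "m = measure lebesgue (box l u)"
  have S: "S \<in> sets borel"
    unfolding S_def by (intro measurable_sets_borel[where M = borel]) auto
  have "f ` S = box l u"
    unfolding S_def using bij by (simp add: bij_is_surj surj_image_vimage_eq)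
  moreover have "f ` S \<in> lmeasurable \<and> measure lebesgue (f ` S) = m
      \<longleftrightarrow> ((\<lambda>x. \<bar>det (matrix (f' x))\<bar>) has_integral m) S"
    using S der bij by (intro has_measure_differentiable_image)
       (auto intro: has_derivative_at_withinI inj_on_subset bij_is_inj)
  ultimately have "((\<lambda>x. 1::real) has_integral m) S"
    by (simp add: det m_def)
  then have "emeasure lborel S = ennreal m"
    using has_integral_iff_emeasure_lborel[OF S, of m] by (simp add: m_def)
  then have "emeasure (distr lborel borel f) (box l u) = ennreal m"
    by (simp add: emeasure_distr S_def)
  also have "ennreal m = ennreal (measure lborel (box l u))"
    by (simp add: m_def)
  also have "\<dots> = emeasure lborel (box l u)"
    by (rule emeasure_eq_ennreal_measure[symmetric]) (use emeasure_lborel_box_finite in \<open>auto simp: less_top\<close>)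
  finally show "emeasure (distr lborel borel f) (box l u) = ennreal (prod ((\<bullet>) (u - l)) Basis)"
    using le by (simp add: emeasure_lborel_box)
qed simp

lemma distr_lborel_unimodular_cart:
  fixes f :: "real ^ 'n::finite \<Rightarrow> real ^ 'n"
  assumes der: "\<And>x. (f has_derivative f' x) (at x)"
    and det: "\<And>x. \<bar>det (matrix (to_copy_vec \<circ> f' x \<circ> of_copy_vec))\<bar> = 1" and bij: "bij f"
  shows "distr lborel borel f = lborel"
proof -
  define g where "g = to_copy_vec \<circ> f \<circ> of_copy_vec"
  have "(g has_derivative (to_copy_vec \<circ> f' (of_copy_vec x) \<circ> of_copy_vec)) (at x)" for x
    unfolding g_def
    by (intro diff_chain_at der linear_imp_has_derivative linear_to_copy_vec linear_of_copy_vec)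
  moreover have "bij (to_copy_vec :: real ^ 'n \<Rightarrow> _)" "bij (of_copy_vec :: _ \<Rightarrow> real ^ 'n)"
    by (rule bij_betw_byWitness[where f' = of_copy_vec]; auto)
       (rule bij_betw_byWitness[where f' = to_copy_vec]; auto)
  then have "bij g"
    unfolding g_def using bij by (intro bij_comp)
  ultimately have g: "distr lborel borel g = lborel"
    using det by (intro distr_lborel_unimodular[where f' = "\<lambda>x. to_copy_vec \<circ> f' (of_copy_vec x) \<circ> of_copy_vec"]) auto
  have cont: "continuous_on UNIV f"
    by (intro continuous_at_imp_continuous_on ballI has_derivative_continuous[OF der])
  then have [measurable]: "f \<in> borel_measurable borel"
    by (rule borel_measurable_continuous_onI)
  have [measurable]: "g \<in> borel_measurable borel"
    by (simp add: g_def comp_def)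
  have "f = of_copy_vec \<circ> (g \<circ> to_copy_vec)"
    by (auto simp: g_def)
  then have "distr lborel borel f = distr (distr (distr lborel borel to_copy_vec) borel g) borel of_copy_vec"
    by (simp add: distr_distr)
  then show ?thesis
    by (simp add: g distr_to_copy_vec distr_of_copy_vec)
qed

section \<open>Dilations\<close>

lemma dil_nth [simp]: "dil \<nu> r x $ i = r powr \<nu> i * x $ i"
  by (simp add: dil_def)

lemma linear_dil: "linear (dil \<nu> r)"
  by (intro linearI) (auto simp: vec_eq_iff algebra_simps)

lemma dil_0 [simp]: "dil \<nu> r 0 = 0" and dil_minus [simp]: "dil \<nu> r (- x) = - dil \<nu> r x"
  and dil_1 [simp]: "dil \<nu> 1 x = x"
  by (simp_all add: vec_eq_iff)

lemma dil_dil: "0 < r \<Longrightarrow> 0 < s \<Longrightarrow> dil \<nu> r (dil \<nu> s x) = dil \<nu> (r * s) x"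
  by (simp add: vec_eq_iff powr_mult)

lemma dil_inverse [simp]:
  "0 < r \<Longrightarrow> dil \<nu> r (dil \<nu> (1 / r) x) = x" "0 < r \<Longrightarrow> dil \<nu> (1 / r) (dil \<nu> r x) = x"
  by (simp_all add: dil_dil)

lemma dil_eq_0_iff [simp]: "0 < r \<Longrightarrow> dil \<nu> r x = 0 \<longleftrightarrow> x = 0"
  by (metis dil_0 dil_inverse(2))

lemma continuous_on_dil [continuous_intros]:
  assumes "continuous_on S f" "continuous_on S g" "\<And>x. x \<in> S \<Longrightarrow> 0 < f x"
  shows "continuous_on S (\<lambda>x. dil \<nu> (f x) (g x))"
  unfolding dil_def using assms by (intro continuous_intros) (auto simp: less_imp_neq[symmetric])

lemma measurable_dil [measurable]: "dil \<nu> r \<in> borel_measurable borel"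
  using linear_dil
  by (auto intro!: borel_measurable_continuous_onI linear_continuous_on simp: linear_conv_bounded_linear)

lemma dil_tendsto_0:
  assumes "\<And>i. 0 < \<nu> i"
  shows "((\<lambda>r. dil \<nu> r x) \<longlongrightarrow> 0) (at_right 0)"
proof (rule vec_tendstoI)
  fix i
  have "((\<lambda>r. r powr \<nu> i * x $ i) \<longlongrightarrow> 0 * x $ i) (at_right 0)"
    by (intro tendsto_intros tendsto_zero_powrI[where b = "\<nu> i"] assms)
       (auto simp: eventually_at_right_less eventually_at_filter)
  then show "((\<lambda>r. dil \<nu> r x $ i) \<longlongrightarrow> 0 $ i) (at_right 0)"
    by simp
qed

text \<open>The exponent is negative because a set is measured through its preimage, whose volume is
  that of the set divided by \<open>r powr hom_dim \<nu>\<close>.\<close>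

lemma distr_dil:
  assumes r: "0 < r"
  shows "distr lborel borel (dil \<nu> r) = density lborel (\<lambda>_. ennreal (r powr - hom_dim \<nu>))"
    (is "_ = density _ (\<lambda>_. ennreal ?c)")
proof -
  \<comment> \<open>The diagonal form in which the affine change of variables expects the
    dilation.\<close>
  have T: "(\<Sum>j\<in>Basis. ((dil \<nu> r j \<bullet> j) * (x \<bullet> j)) *\<^sub>R j) = dil \<nu> r x" for x
  proof -
    have b: "(Basis :: (real ^ 'a) set) = (\<lambda>i. axis i 1) ` UNIV"
      by (auto simp: Basis_vec_def)
    have inj: "inj (\<lambda>i::'a. axis i (1::real))"
      by (auto simp: inj_on_def axis_eq_axis)
    show ?thesis
      unfolding b sum.reindex[OF inj]
      by (simp add: inner_axis vec_eq_iff) (simp add: axis_def if_distrib cong: if_cong)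
  qed
  have nz: "dil \<nu> r j \<bullet> j \<noteq> 0" if "j \<in> Basis" for j
    using that r by (auto simp: Basis_vec_def inner_axis)
  have "lborel = density (distr lborel borel (dil \<nu> r)) (\<lambda>_. (\<Prod>j\<in>Basis. \<bar>dil \<nu> r j \<bullet> j\<bar>))"
    using lborel_affine_euclidean[of "\<lambda>j. (dil \<nu> r j \<bullet> j)" 0, OF nz] by (simp add: T)
  also have "(\<Prod>j\<in>(Basis :: (real ^ 'a) set). \<bar>dil \<nu> r j \<bullet> j\<bar>) = r powr hom_dim \<nu>"
    using r by (simp add: prod_Basis_vec inner_axis hom_dim_def powr_sum)
  finally have 1: "lborel = density (distr lborel borel (dil \<nu> r)) (\<lambda>_. r powr hom_dim \<nu>)" .
  \<comment> \<open>That change of variables puts the factor on the pushforward; multiplying by the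
    reciprocal moves it to \<open>lborel\<close>.\<close>
  have "density lborel (\<lambda>_. ennreal ?c)
      = density (density (distr lborel borel (dil \<nu> r)) (\<lambda>_. r powr hom_dim \<nu>)) (\<lambda>_. ennreal ?c)"
    using 1 by simp
  also have "\<dots> = density (distr lborel borel (dil \<nu> r)) (\<lambda>_. ennreal (r powr hom_dim \<nu>) * ennreal ?c)"
    by (subst density_density_eq) auto
  also have "ennreal (r powr hom_dim \<nu>) * ennreal ?c = 1"
    using r by (simp add: powr_minus flip: ennreal_mult)
  also have "density (distr lborel borel (dil \<nu> r)) (\<lambda>_. 1) = distr lborel borel (dil \<nu> r)"
    by (rule density_1)
  finally show ?thesis
    by simp
qed

lemma nn_integral_dil:
  assumes r: "0 < r" and f [measurable]: "f \<in> borel_measurable borel"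
  shows "(\<integral>\<^sup>+x. f (dil \<nu> r x) \<partial>lborel) = ennreal (r powr - hom_dim \<nu>) * (\<integral>\<^sup>+x. f x \<partial>lborel)"
proof -
  have "(\<integral>\<^sup>+x. f (dil \<nu> r x) \<partial>lborel) = (\<integral>\<^sup>+x. f x \<partial>distr lborel borel (dil \<nu> r))"
    by (simp add: nn_integral_distr)
  then show ?thesis
    by (simp add: distr_dil[OF r] nn_integral_density nn_integral_cmult)
qed

section \<open>Smooth functions\<close>

lemma smooth_on_differentiable:
  "smooth_on S f \<Longrightarrow> set bs \<subseteq> Basis \<Longrightarrow> x \<in> S \<Longrightarrow> partials bs f differentiable (at x)"
  by (simp add: smooth_on_def)

lemma smooth_on_continuous:
  "smooth_on S f \<Longrightarrow> set bs \<subseteq> Basis \<Longrightarrow> continuous_on S (partials bs f)"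
  by (meson smooth_on_differentiable continuous_at_imp_continuous_on differentiable_imp_continuous_within)

section \<open>Homogeneous groups\<close>

context homogeneous_group
begin

lemma mul_0 [simp]: "mul x 0 = x" "mul 0 x = x"
  using one_param[of 1 x 0] one_param[of 0 x 1] by simp_all

lemma mul_minus [simp]: "mul x (- x) = 0" "mul (- x) x = 0"
  using one_param[of 1 x "-1"] one_param[of "-1" x 1] by simp_all

lemma mul_minus_cancel [simp]:
  "mul (mul x y) (- y) = x" "mul (mul x (- y)) y = x" "mul (- x) (mul x y) = y" "mul x (mul (- x) y) = y"
  by (simp add: assoc, simp add: assoc, simp_all add: assoc[symmetric])

lemma minus_mul: "- mul x y = mul (- y) (- x)"
  by (metis mul_minus_cancel(1,3))

lemma mul_eq_0_iff: "mul x y = 0 \<longleftrightarrow> y = - x"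
  by (metis mul_0(1) mul_minus(1) mul_minus_cancel(3))

abbreviation "uncurried_mul \<equiv> (\<lambda>(x, y). mul x y)"

lemma mul_has_derivative:
  "(uncurried_mul has_derivative frechet_derivative uncurried_mul (at z)) (at z)"
  using smooth_on_differentiable[OF smooth_mul, of "[]" z] by (simp add: frechet_derivative_works)

lemma continuous_on_mul [continuous_intros]:
  assumes "continuous_on S f" "continuous_on S g"
  shows "continuous_on S (\<lambda>x. mul (f x) (g x))"
proof -
  have "continuous_on UNIV uncurried_mul"
    using smooth_on_continuous[OF smooth_mul, of "[]"] by simp
  from continuous_on_compose2[OF this continuous_on_Pair[OF assms]] show ?thesis
    by simp
qed

lemma measurable_mul [measurable]:
  assumes "f \<in> borel_measurable M" "g \<in> borel_measurable M"
  shows "(\<lambda>x. mul (f x) (g x)) \<in> borel_measurable M"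
  using assms by (rule borel_measurable_continuous_Pair) (intro continuous_intros)

section \<open>The Jacobian of right translations\<close>

text \<open>The differential of the right translation by \<open>snd z\<close> at
  \<open>fst z\<close>. Both points are packed into \<open>z\<close> because the determinant
  argument lets them shrink to the origin together.\<close>

definition left_derivative :: "(real ^ 'n) \<times> (real ^ 'n) \<Rightarrow> real ^ 'n \<Rightarrow> real ^ 'n" where
  "left_derivative z h = frechet_derivative uncurried_mul (at z) (h, 0)"

lemma mul_left_has_derivative:
  "((\<lambda>v. mul v x) has_derivative left_derivative (v, x)) (at v)"
proof -
  have "((\<lambda>v. (v, x)) has_derivative (\<lambda>h. (h, 0))) (at v)"
    by (auto intro!: derivative_eq_intros)
  from diff_chain_at[OF this mul_has_derivative] show ?thesis
    by (simp add: o_def left_derivative_def[abs_def])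
qed

lemma linear_left_derivative: "linear (left_derivative z)"
  using mul_left_has_derivative[of "snd z" "fst z"] has_derivative_linear by force

lemma left_derivative_0: "left_derivative (v, 0) = id"
proof -
  have "(id has_derivative left_derivative (v, 0)) (at v)"
    using mul_left_has_derivative[of 0 v] by (simp add: id_def)
  then show ?thesis
    using has_derivative_unique has_derivative_id by (metis eq_id_iff)
qed

text \<open>Both sides differentiate \<open>v \<mapsto> dil \<nu> r (mul v x)\<close>, once directly
  and once after rewriting by \<open>dil_mul\<close>; derivatives are unique.\<close>

lemma left_derivative_dil:
  assumes "0 < r"
  shows "dil \<nu> r \<circ> left_derivative (v, x) = left_derivative (dil \<nu> r v, dil \<nu> r x) \<circ> dil \<nu> r"
proof -
  have d: "(dil \<nu> r has_derivative dil \<nu> r) (at y)" for y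
    by (intro linear_imp_has_derivative linear_dil)
  have "((\<lambda>v. dil \<nu> r (mul v x)) has_derivative dil \<nu> r \<circ> left_derivative (v, x)) (at v)"
    using diff_chain_at[OF mul_left_has_derivative d] by (simp add: o_def)
  moreover have "((\<lambda>v. dil \<nu> r (mul v x)) has_derivative left_derivative (dil \<nu> r v, dil \<nu> r x) \<circ> dil \<nu> r) (at v)"
    using diff_chain_at[OF d mul_left_has_derivative] assms by (simp add: o_def dil_mul)
  ultimately show ?thesis
    by (rule has_derivative_unique)
qed

abbreviation copy_matrix :: "(real ^ 'n \<Rightarrow> real ^ 'n) \<Rightarrow> _" where
  "copy_matrix F \<equiv> matrix (to_copy_vec \<circ> F \<circ> of_copy_vec)"

lemma copy_matrix_comp:
  assumes "linear F" "linear G"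
  shows "copy_matrix (F \<circ> G) = copy_matrix F ** copy_matrix G"
proof -
  have "to_copy_vec \<circ> (F \<circ> G) \<circ> of_copy_vec
      = (to_copy_vec \<circ> F \<circ> of_copy_vec) \<circ> (to_copy_vec \<circ> G \<circ> of_copy_vec)"
    by auto
  then show ?thesis
    using assms by (simp only:)
      (intro matrix_compose linear_compose linear_to_copy_vec linear_of_copy_vec)
qed

text \<open>The entries are first partial derivatives of the smooth product, and the determinant is
  a polynomial in them.\<close>

lemma continuous_det_left_derivative:
  "continuous_on UNIV (\<lambda>z. det (copy_matrix (left_derivative z)))"
proof -
  have "continuous_on UNIV (\<lambda>z. copy_matrix (left_derivative z) $ i $ j)" for i j
  proof -
    have e: "of_copy_vec (axis j 1) = (axis (of_copy j) 1 :: real ^ 'n)"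
      by (simp add: vec_eq_iff of_copy_vec_def axis_def) (metis of_to_copy)
    have "continuous_on UNIV (partials [(axis (of_copy j) 1, 0)] uncurried_mul)"
      by (intro smooth_on_continuous[OF smooth_mul]) (auto simp: Basis_prod_def axis_in_Basis_iff)
    then have "continuous_on UNIV (\<lambda>z. left_derivative z (axis (of_copy j) 1) $ of_copy i)"
      by (intro continuous_on_component) (simp add: left_derivative_def)
    then show ?thesis
      by (simp add: matrix_def e) (simp add: to_copy_vec_def)
  qed
  then show ?thesis
    unfolding det_def
    by (intro continuous_on_sum continuous_on_mult continuous_on_const continuous_on_prod) auto
qed

lemma det_left_derivative: "det (copy_matrix (left_derivative (v, x))) = 1"
proof -
  define J where "J z = det (copy_matrix (left_derivative z))" for z
  have id: "copy_matrix id = mat 1"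
    by (simp add: o_def flip: matrix_id_mat_1 id_def)
  \<comment> \<open>By \<open>left_derivative_dil\<close> the determinant of the dilation multiplies
    both Jacobians. It is nonzero, since \<open>dil \<nu> (1 / r)\<close> inverts the dilation, and
    so it cancels.\<close>
  have inv: "J (dil \<nu> r v, dil \<nu> r x) = J (v, x)" if r: "0 < r" for r
  proof -
    have "copy_matrix (dil \<nu> r) ** copy_matrix (dil \<nu> (1 / r)) = mat 1"
    proof -
      have "dil \<nu> r \<circ> dil \<nu> (1 / r) = id"
        using r by auto
      then show ?thesis
        by (simp only: copy_matrix_comp[OF linear_dil linear_dil, symmetric] id)
    qed
    then have "det (copy_matrix (dil \<nu> r)) \<noteq> 0"
      by (metis det_I det_mul mult_zero_left zero_neq_one)
    moreover have "det (copy_matrix (dil \<nu> r)) * J (v, x) = J (dil \<nu> r v, dil \<nu> r x) * det (copy_matrix (dil \<nu> r))"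
      unfolding J_def
      by (simp only: det_mul[symmetric] copy_matrix_comp[symmetric] linear_dil linear_left_derivative
            left_derivative_dil[OF r])
    ultimately show ?thesis
      by simp
  qed
  have "isCont J (0, 0)"
    using continuous_det_left_derivative by (simp add: J_def[abs_def] continuous_on_eq_continuous_at)
  moreover have "((\<lambda>r. (dil \<nu> r v, dil \<nu> r x)) \<longlongrightarrow> (0, 0)) (at_right 0)"
    by (intro tendsto_Pair dil_tendsto_0 weight_pos)
  ultimately have "((\<lambda>r. J (dil \<nu> r v, dil \<nu> r x)) \<longlongrightarrow> J (0, 0)) (at_right 0)"
    by (rule isCont_tendsto_compose)
  moreover have "((\<lambda>r. J (dil \<nu> r v, dil \<nu> r x)) \<longlongrightarrow> J (v, x)) (at_right 0)"
    by (rule tendsto_eventually) (auto simp: eventually_at_right_less inv eventually_at_filter)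
  ultimately have "J (v, x) = J (0, 0)"
    by (intro tendsto_unique[of "at_right 0"]) auto
  then show ?thesis
    by (simp only: J_def left_derivative_0 id det_I)
qed

lemma distr_lborel_mul: "distr lborel borel (\<lambda>v. mul v x) = lborel"
proof (rule distr_lborel_unimodular_cart)
  show "bij (\<lambda>v. mul v x)"
    by (rule bij_betw_byWitness[where f' = "\<lambda>v. mul v (- x)"]) auto
qed (auto intro: mul_left_has_derivative simp: det_left_derivative)

text \<open>In exponential coordinates inversion is \<open>uminus\<close>, which preserves Lebesgue
  measure; a right translation follows. This justifies the substitution
  \<open>u = w^-1 x\<close>.\<close>

lemma distr_lborel_minus_mul: "distr lborel borel (\<lambda>w. mul (- w) x) = lborel"
proof -
  have neg: "distr lborel borel (uminus :: real ^ 'n \<Rightarrow> _) = lborel"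
    using lborel_affine[of "-1" "0 :: real ^ 'n"] by (simp add: density_1 flip: one_ennreal_def)
  have "distr lborel borel (\<lambda>w. mul (- w) x) = distr (distr lborel borel uminus) borel (\<lambda>v. mul v x)"
    by (subst distr_distr) (auto simp: o_def)
  then show ?thesis
    by (simp add: neg distr_lborel_mul)
qed

end

section \<open>Homogeneous quasi-norms\<close>

locale quasi_normed_group = homogeneous_group mul \<nu>
  for mul :: "real ^ 'n::finite \<Rightarrow> real ^ 'n \<Rightarrow> real ^ 'n" and \<nu> +
  fixes N :: "real ^ 'n \<Rightarrow> real"
  assumes quasi_norm: "homogeneous_quasi_norm \<nu> N"
begin

abbreviation Q :: real where "Q \<equiv> hom_dim \<nu>"

lemma N_continuous: "continuous_on S N"
  using quasi_norm continuous_on_subset unfolding homogeneous_quasi_norm_def by blast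

lemma continuous_on_N [continuous_intros]: "continuous_on S f \<Longrightarrow> continuous_on S (\<lambda>x. N (f x))"
  by (rule continuous_on_compose2[OF N_continuous[of UNIV]]) auto

lemma measurable_N [measurable]: "N \<in> borel_measurable borel"
  by (rule borel_measurable_continuous_onI[OF N_continuous])

lemma N_nonneg [simp]: "0 \<le> N x" and N_minus [simp]: "N (- x) = N x"
  and N_dil: "0 < r \<Longrightarrow> N (dil \<nu> r x) = r * N x" and N_eq_0_iff [simp]: "N x = 0 \<longleftrightarrow> x = 0"
  using quasi_norm by (auto simp: homogeneous_quasi_norm_def)

lemma N_0 [simp]: "N 0 = 0"
  by simp

lemma N_pos_iff [simp]: "0 < N x \<longleftrightarrow> x \<noteq> 0"
  using N_nonneg[of x] N_eq_0_iff[of x] by linarith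

section \<open>Compactness of the balls of the quasi-norm\<close>

text \<open>Take for \<open>m\<close> the minimum of \<open>N\<close> on the Euclidean unit sphere.
  A point with \<open>norm x \<ge> 1\<close> meets that sphere when dilated by some
  \<open>r \<le> 1\<close>, which cannot raise \<open>N\<close>; hence
  \<open>N x \<ge> m\<close>.\<close>

lemma small_norm_if_small_N: "\<exists>m>0. \<forall>x. N x < m \<longrightarrow> norm x < 1"
proof -
  have "(axis i 1 :: real ^ 'n) \<in> sphere 0 1" for i
    by simp
  then have "sphere 0 1 \<noteq> ({} :: (real ^ 'n) set)"
    by blast
  then obtain z where z: "z \<in> sphere 0 1" "\<And>x. x \<in> sphere 0 1 \<Longrightarrow> N z \<le> N x"
    using continuous_attains_inf[OF compact_sphere _ N_continuous] by metis
  have "norm x < 1" if x: "N x < N z" for x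
  proof (rule ccontr)
    assume "\<not> norm x < 1"
    \<comment> \<open>Writing \<open>x\<close> as \<open>dil \<nu> 1 x\<close> supplies the right
      endpoint for the intermediate value theorem.\<close>
    then have x1: "1 \<le> norm (dil \<nu> 1 x)" by simp
    have "((\<lambda>r. norm (dil \<nu> r x)) \<longlongrightarrow> 0) (at_right 0)"
      using tendsto_norm[OF dil_tendsto_0[of \<nu> x]] weight_pos by simp
    then have "\<forall>\<^sub>F r in at_right 0. norm (dil \<nu> r x) < 1"
      by (rule order_tendstoD) simp
    moreover have "\<forall>\<^sub>F r in at_right 0. r < (1::real)"
      by (rule eventually_at_rightI[of 0 1]) auto
    moreover have "\<forall>\<^sub>F r in at_right 0. 0 < (r::real)"
      by (rule eventually_at_right_less)
    ultimately have "\<forall>\<^sub>F r in at_right 0. norm (dil \<nu> r x) < 1 \<and> r < 1 \<and> 0 < r"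
      by (intro eventually_conj)
    then obtain r0 where r0: "norm (dil \<nu> r0 x) < 1" "r0 < 1" "0 < r0"
      using eventually_happens'[OF trivial_limit_at_right_real] by blast
    have "continuous_on {r0..1} (\<lambda>r. norm (dil \<nu> r x))"
      using r0 by (intro continuous_intros) auto
    then obtain r where r: "r0 \<le> r" "r \<le> 1" "norm (dil \<nu> r x) = 1"
      using IVT'[of "\<lambda>r. norm (dil \<nu> r x)" r0 1 1] r0 x1 by auto
    then have "N z \<le> r * N x"
      using z(2)[of "dil \<nu> r x"] r0 by (simp add: N_dil)
    also have "\<dots> \<le> 1 * N x"
      using r by (intro mult_right_mono) auto
    finally show False
      using x by simp
  qed
  moreover have "0 < N z"
    using z(1) by auto
  ultimately show ?thesis
    by blast
qed

lemma compact_N_le: "compact {x. N x \<le> R}"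
proof (cases "0 < R")
  case True
  obtain m where m: "0 < m" "\<And>x. N x < m \<Longrightarrow> norm x < 1"
    using small_norm_if_small_N by blast
  \<comment> \<open>The factor 2 makes \<open>r * R\<close> strictly smaller than
    \<open>m\<close>.\<close>
  define r where "r = m / (2 * R)"
  have r: "0 < r"
    using m True by (simp add: r_def)
  have "{x. N x \<le> R} \<subseteq> dil \<nu> (1 / r) ` cball 0 1"
  proof
    fix x assume "x \<in> {x. N x \<le> R}"
    then have "r * N x \<le> r * R"
      using r by (intro mult_left_mono) auto
    also have "r * R < m"
      using True m by (simp add: r_def)
    finally have "norm (dil \<nu> r x) < 1"
      using r by (intro m) (simp add: N_dil)
    then show "x \<in> dil \<nu> (1 / r) ` cball 0 1"
      using r by (intro image_eqI[of _ _ "dil \<nu> r x"]) auto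
  qed
  moreover have "bounded (dil \<nu> (1 / r) ` cball 0 1)"
    using linear_dil by (intro bounded_linear_image) (auto simp: linear_conv_bounded_linear)
  moreover have "closed {x. N x \<le> R}"
    by (intro closed_Collect_le continuous_intros)
  ultimately show ?thesis
    using bounded_subset compact_eq_bounded_closed by blast
next
  case False
  then have "{x. N x \<le> R} \<subseteq> {0}"
    using N_nonneg N_eq_0_iff by (smt (verit) mem_Collect_eq singletonI subsetI)
  then show ?thesis
    using finite_subset finite_imp_compact by blast
qed

section \<open>Integrability of powers of the quasi-norm\<close>

text \<open>The integral over the dilate of \<open>A\<close> by \<open>b ^ k\<close> is
  \<open>c ^ k\<close> times the integral over \<open>A\<close>, where
  \<open>c = b powr (s + Q) < 1\<close>. The dilates cover \<open>B\<close>, possibly with overlaps,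
  so a geometric series is an upper bound. It serves with \<open>b = 1 / 2\<close> near the origin
  and with \<open>b = 2\<close> at infinity.\<close>

lemma nn_integral_homogeneous_finite:
  fixes f :: "real ^ 'n \<Rightarrow> ennreal"
  assumes f [measurable]: "f \<in> borel_measurable borel" and A [measurable]: "A \<in> sets borel"
    and hom: "\<And>r x. 0 < r \<Longrightarrow> f (dil \<nu> r x) = ennreal (r powr s) * f x"
    and b: "0 < b" "b powr (s + Q) < 1"
    and fin: "(\<integral>\<^sup>+x. f x * indicator A x \<partial>lborel) < \<infinity>"
    and cover: "\<And>x. x \<in> B \<Longrightarrow> \<exists>k::nat. dil \<nu> (1 / b ^ k) x \<in> A"
  shows "(\<integral>\<^sup>+x. f x * indicator B x \<partial>lborel) < \<infinity>"
proof -
  define I where "I = (\<integral>\<^sup>+x. f x * indicator A x \<partial>lborel)"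
  define c where "c = b powr (s + Q)"
  have c: "0 \<le> c" "c < 1"
    using b by (auto simp: c_def)
  have piece: "(\<integral>\<^sup>+x. f x * indicator A (dil \<nu> (1 / b ^ k) x) \<partial>lborel) = ennreal (c ^ k) * I" for k
  proof -
    let ?t = "b ^ k"
    have t: "0 < ?t" "0 < 1 / ?t"
      using b by auto
    have "(\<integral>\<^sup>+x. f x * indicator A (dil \<nu> (1 / ?t) x) \<partial>lborel)
        = (\<integral>\<^sup>+x. (\<lambda>y. ennreal (?t powr s) * (f y * indicator A y)) (dil \<nu> (1 / ?t) x) \<partial>lborel)"
      using t by (intro nn_integral_cong) (simp add: mult.assoc[symmetric] flip: hom)
    also have "\<dots> = ennreal ((1 / ?t) powr - Q) * (ennreal (?t powr s) * I)"
      using t by (subst nn_integral_dil) (auto simp: nn_integral_cmult I_def)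
    also have "\<dots> = ennreal ((1 / ?t) powr - Q * ?t powr s) * I"
      by (simp add: ennreal_mult mult.assoc)
    also have "(1 / ?t) powr - Q * ?t powr s = c ^ k"
      using b by (simp add: c_def powr_minus powr_divide powr_add powr_powr field_simps flip: powr_realpow)
    finally show ?thesis .
  qed
  have "(\<integral>\<^sup>+x. f x * indicator B x \<partial>lborel)
      \<le> (\<integral>\<^sup>+x. (\<Sum>k. f x * indicator A (dil \<nu> (1 / b ^ k) x)) \<partial>lborel)"
  proof (intro nn_integral_mono)
    fix x
    show "f x * indicator B x \<le> (\<Sum>k. f x * indicator A (dil \<nu> (1 / b ^ k) x))"
    proof (cases "x \<in> B")
      case True
      then obtain k where "dil \<nu> (1 / b ^ k) x \<in> A"
        using cover by blast
      then have "f x * indicator B x \<le> (\<Sum>j\<in>{k}. f x * indicator A (dil \<nu> (1 / b ^ j) x))"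
        using True by simp
      also have "\<dots> \<le> (\<Sum>k. f x * indicator A (dil \<nu> (1 / b ^ k) x))"
        by (rule sum_le_suminf) auto
      finally show ?thesis .
    qed simp
  qed
  also have "\<dots> = (\<Sum>k. ennreal (c ^ k) * I)"
    by (subst nn_integral_suminf) (auto simp: piece)
  also have "\<dots> = (\<Sum>k. ennreal (c ^ k)) * I"
    by simp
  also have "(\<Sum>k. ennreal (c ^ k)) = ennreal (1 / (1 - c))"
    using c by (subst suminf_ennreal2) (auto simp: suminf_geometric)
  also have "ennreal (1 / (1 - c)) * I < \<infinity>"
    using fin by (auto simp: I_def ennreal_mult_less_top)
  finally show ?thesis .
qed

text \<open>On the annulus \<open>N x powr s\<close> is at most its value at one of the two radii,
  depending on the sign of \<open>s\<close>; the sum of both values covers either case.\<close>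

lemma nn_integral_N_powr_annulus:
  assumes "0 < a"
  shows "(\<integral>\<^sup>+x. ennreal (N x powr s) * indicator {x. a \<le> N x \<and> N x \<le> b} x \<partial>lborel) < \<infinity>"
proof -
  have [measurable]: "{x. N x \<le> b} \<in> sets borel"
    by measurable
  have "(\<integral>\<^sup>+x. ennreal (N x powr s) * indicator {x. a \<le> N x \<and> N x \<le> b} x \<partial>lborel)
      \<le> (\<integral>\<^sup>+x. ennreal (a powr s + b powr s) * indicator {x. N x \<le> b} x \<partial>lborel)"
  proof (intro nn_integral_mono)
    fix x
    have "N x powr s \<le> a powr s + b powr s" if "a \<le> N x" "N x \<le> b"
    proof (cases "0 \<le> s")
      case True
      then have "N x powr s \<le> b powr s"
        using that by (intro powr_mono2) auto
      then show ?thesis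
        by (simp add: add_increasing)
    next
      case False
      then have "N x powr s \<le> a powr s"
        using that assms by (intro powr_mono2') auto
      then show ?thesis
        by (simp add: add_increasing2)
    qed
    then show "ennreal (N x powr s) * indicator {x. a \<le> N x \<and> N x \<le> b} x
        \<le> ennreal (a powr s + b powr s) * indicator {x. N x \<le> b} x"
      by (auto simp: indicator_def simp del: ennreal_plus intro!: ennreal_leI)
  qed
  also have "\<dots> = ennreal (a powr s + b powr s) * emeasure lborel {x. N x \<le> b}"
    by (simp add: nn_integral_cmult_indicator)
  also have "\<dots> < \<infinity>"
    using emeasure_compact_finite[OF compact_N_le] by (simp add: ennreal_mult_less_top)
  finally show ?thesis .
qed

lemma nn_integral_N_powr_near:
  assumes s: "0 < s + Q" and R: "0 < R"
  shows "(\<integral>\<^sup>+x. ennreal (N x powr s) * indicator {x. N x \<le> R} x \<partial>lborel) < \<infinity>"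
proof -
  \<comment> \<open>The origin is left out because no dilate of it meets the annulus.\<close>
  have "(\<integral>\<^sup>+x. ennreal (N x powr s) * indicator ({x. N x \<le> R} - {0}) x \<partial>lborel) < \<infinity>"
  proof (rule nn_integral_homogeneous_finite)
    show "(1 / 2) powr (s + Q) < (1::real)"
      using s gr_one_powr[of 2 "s + Q"] by (simp add: powr_divide)
    show "(\<integral>\<^sup>+x. ennreal (N x powr s) * indicator {x. R / 2 \<le> N x \<and> N x \<le> R} x \<partial>lborel) < \<infinity>"
      using R by (intro nn_integral_N_powr_annulus) simp
    fix x assume x: "x \<in> {x. N x \<le> R} - {0}"
    obtain k0 where "R / N x < 2 ^ k0"
      using real_arch_pow[of 2 "R / N x"] by auto
    also have "(2::real) ^ k0 \<le> 2 ^ Suc k0"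
      by simp
    finally have ex: "\<exists>k. R < N x * 2 ^ Suc k"
      using x by (auto simp: field_simps)
    \<comment> \<open>The least such \<open>k\<close> places the dilated point in the annulus:
      \<open>R / 2 < 2 ^ k * N x\<close> by choice, and \<open>2 ^ k * N x \<le> R\<close> by
      minimality or, for \<open>k = 0\<close>, because \<open>N x \<le> R\<close>.\<close>
    define k where "k = (LEAST k. R < N x * 2 ^ Suc k)"
    have k: "R < N x * 2 ^ Suc k"
      unfolding k_def by (rule LeastI_ex[OF ex])
    have "N x * 2 ^ k \<le> R"
    proof (cases k)
      case (Suc j)
      then have "\<not> R < N x * 2 ^ Suc j"
        using not_less_Least[of j "\<lambda>k. R < N x * 2 ^ Suc k"] by (simp add: k_def)
      then show ?thesis
        using Suc by simp
    qed (use x in auto)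
    then show "\<exists>k. dil \<nu> (1 / (1 / 2) ^ k) x \<in> {x. R / 2 \<le> N x \<and> N x \<le> R}"
      using k by (intro exI[of _ k]) (simp add: N_dil power_one_over field_simps)
  qed (auto simp: N_dil powr_mult ennreal_mult)
  \<comment> \<open>Restoring the origin changes nothing, as \<open>0 powr s = 0\<close>.\<close>
  also have "(\<integral>\<^sup>+x. ennreal (N x powr s) * indicator ({x. N x \<le> R} - {0}) x \<partial>lborel)
      = (\<integral>\<^sup>+x. ennreal (N x powr s) * indicator {x. N x \<le> R} x \<partial>lborel)"
    by (intro nn_integral_cong) (auto simp: indicator_def)
  finally show ?thesis .
qed

lemma nn_integral_N_powr_far:
  assumes s: "s + Q < 0" and R: "0 < R"
  shows "(\<integral>\<^sup>+x. ennreal (N x powr s) * indicator {x. R \<le> N x} x \<partial>lborel) < \<infinity>"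
proof (rule nn_integral_homogeneous_finite)
  show "2 powr (s + Q) < (1::real)"
    using s powr_less_mono[of "s + Q" 0 2] by simp
  show "(\<integral>\<^sup>+x. ennreal (N x powr s) * indicator {x. R \<le> N x \<and> N x \<le> 2 * R} x \<partial>lborel) < \<infinity>"
    using R by (intro nn_integral_N_powr_annulus)
  fix x assume x: "x \<in> {x. R \<le> N x}"
  obtain k0 where "N x / R < 2 ^ k0"
    using real_arch_pow[of 2 "N x / R"] by auto
  also have "(2::real) ^ k0 \<le> 2 ^ Suc k0"
    by simp
  finally have ex: "\<exists>k. N x < R * 2 ^ Suc k"
    using R by (auto simp: field_simps)
  define k where "k = (LEAST k. N x < R * 2 ^ Suc k)"
  have k: "N x < R * 2 ^ Suc k"
    unfolding k_def by (rule LeastI_ex[OF ex])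
  have "R * 2 ^ k \<le> N x"
  proof (cases k)
    case (Suc j)
    then have "\<not> N x < R * 2 ^ Suc j"
      using not_less_Least[of j "\<lambda>k. N x < R * 2 ^ Suc k"] by (simp add: k_def)
    then show ?thesis
      using Suc by simp
  qed (use x in auto)
  then show "\<exists>k. dil \<nu> (1 / 2 ^ k) x \<in> {x. R \<le> N x \<and> N x \<le> 2 * R}"
    using k by (intro exI[of _ k]) (simp add: N_dil field_simps)
qed (auto simp: N_dil powr_mult ennreal_mult)

end

section \<open>Bump functions\<close>

text \<open>Differentiating \<open>exp (- (1 / t))\<close> produces higher powers of
  \<open>1 / t\<close>; the index \<open>k\<close> records them, so that the span of the family is
  closed under differentiation.\<close>

definition flat :: "nat \<Rightarrow> real \<Rightarrow> real" where
  "flat k t = (if 0 < t then exp (- (1 / t)) / t ^ k else 0)"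

lemma flat_tendsto_0: "(flat k \<longlongrightarrow> 0) (at_right 0)"
proof -
  have "((\<lambda>t::real. inverse t ^ k / exp (inverse t)) \<longlongrightarrow> 0) (at_right 0)"
    by (rule filterlim_compose[OF tendsto_power_div_exp_0 filterlim_inverse_at_top_right])
  moreover have "\<forall>\<^sub>F t in at_right 0. inverse t ^ k / exp (inverse t) = flat k t"
    using eventually_at_right_less
    by eventually_elim (simp add: flat_def field_simps power_inverse exp_minus)
  ultimately show ?thesis
    by (rule Lim_transform_eventually)
qed

lemma flat_has_derivative:
  "(flat k has_real_derivative (flat (k + 2) t - real k * flat (k + 1) t)) (at t)"
proof -
  consider "0 < t" | "t < 0" | "t = 0"
    by linarith
  then show ?thesis
  proof cases
    case 1
    then have "((\<lambda>t. exp (- (1 / t)) / t ^ k) has_real_derivative (flat (k + 2) t - real k * flat (k + 1) t)) (at t)"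
      by (auto intro!: derivative_eq_intros simp: flat_def field_simps power2_eq_square)
         (cases k; simp add: field_simps)
    then show ?thesis
      by (rule has_field_derivative_transform_within_open[where S = "{0<..}"]) (use 1 in \<open>auto simp: flat_def\<close>)
  next
    case 2
    then have "((\<lambda>_. 0) has_real_derivative (flat (k + 2) t - real k * flat (k + 1) t)) (at t)"
      by (auto simp: flat_def)
    then show ?thesis
      by (rule has_field_derivative_transform_within_open[where S = "{..<0}"]) (use 2 in \<open>auto simp: flat_def\<close>)
  next
    case 3
    \<comment> \<open>At 0 the difference quotient of \<open>flat k\<close> is 0 from the left and
      \<open>flat (k + 1)\<close> from the right.\<close>
    have "((\<lambda>h. flat k h / h) \<longlongrightarrow> 0) (at 0)"
    proof (rule filterlim_split_at)
      have "\<forall>\<^sub>F h in at_left 0. flat k h / (h::real) = 0"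
        using eventually_at_left_real[of "-1" 0] by (auto simp: flat_def elim: eventually_mono)
      then show "((\<lambda>h. flat k h / h) \<longlongrightarrow> 0) (at_left 0)"
        by (rule tendsto_eventually)
      have "\<forall>\<^sub>F h in at_right 0. flat (Suc k) h = flat k h / (h::real)"
        using eventually_at_right_less by eventually_elim (simp add: flat_def)
      then show "((\<lambda>h. flat k h / h) \<longlongrightarrow> 0) (at_right 0)"
        by (rule Lim_transform_eventually[OF flat_tendsto_0])
    qed
    then show ?thesis
      using 3 by (simp add: DERIV_def flat_def)
  qed
qed

text \<open>A class of functions that contains the bump functions and is closed under partial derivatives.\<close>

inductive_set bump_algebra :: "'a::euclidean_space \<Rightarrow> real \<Rightarrow> ('a \<Rightarrow> complex) set" for a e where
  const: "(\<lambda>_. c) \<in> bump_algebra a e"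
| inner: "(\<lambda>x. of_real (x \<bullet> b)) \<in> bump_algebra a e"
| flat: "(\<lambda>x. of_real (flat k (e\<^sup>2 - (x - a) \<bullet> (x - a)))) \<in> bump_algebra a e"
| add: "f \<in> bump_algebra a e \<Longrightarrow> g \<in> bump_algebra a e \<Longrightarrow> (\<lambda>x. f x + g x) \<in> bump_algebra a e"
| mult: "f \<in> bump_algebra a e \<Longrightarrow> g \<in> bump_algebra a e \<Longrightarrow> (\<lambda>x. f x * g x) \<in> bump_algebra a e"

lemma bump_algebra_derivative:
  "f \<in> bump_algebra a e \<Longrightarrow>
    \<exists>f'. (\<forall>x. (f has_derivative f' x) (at x)) \<and> (\<forall>b. (\<lambda>x. f' x b) \<in> bump_algebra a e)"
proof (induction rule: bump_algebra.induct)
  case (const c)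
  show ?case
    by (rule exI[of _ "\<lambda>_ _. 0"]) (auto intro: bump_algebra.const)
next
  case (inner b)
  have "((\<lambda>x. complex_of_real (x \<bullet> b)) has_derivative (\<lambda>h. of_real (h \<bullet> b))) (at x)" for x
    by (auto intro!: derivative_eq_intros)
  then show ?case
    by (intro exI[of _ "\<lambda>_ h. of_real (h \<bullet> b)"]) (auto intro: bump_algebra.const)
next
  case (flat k)
  define r where "r x = e\<^sup>2 - (x - a) \<bullet> (x - a)" for x
  define d where "d x = flat (k + 2) (r x) - real k * flat (k + 1) (r x)" for x
  have r: "(r has_derivative (\<lambda>h. - 2 * ((x - a) \<bullet> h))) (at x)" for x
    unfolding r_def[abs_def] by (auto intro!: derivative_eq_intros simp: inner_commute)
  have "((\<lambda>x. flat k (r x)) has_derivative (\<lambda>h. d x * (- 2 * ((x - a) \<bullet> h)))) (at x)" for x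
    using diff_chain_at[OF r flat_has_derivative[of k "r x", unfolded has_field_derivative_def]]
    by (simp add: o_def d_def mult_ac)
  then have "((\<lambda>x. complex_of_real (flat k (r x))) has_derivative (\<lambda>h. of_real (d x * (- 2 * ((x - a) \<bullet> h))))) (at x)" for x
    by (rule has_derivative_of_real)
  moreover have "(\<lambda>x. complex_of_real (d x * (- 2 * ((x - a) \<bullet> b)))) \<in> bump_algebra a e" for b
  proof -
    \<comment> \<open>Differences are rewritten with constants, sums and products, the forms that
      the inductive rules provide.\<close>
    have "(\<lambda>x. (of_real (flat (k + 2) (r x)) + - of_nat k * of_real (flat (k + 1) (r x)))
        * (- 2 * (of_real (x \<bullet> b) + - of_real (a \<bullet> b)))) \<in> bump_algebra a e"
      unfolding r_def by (intro bump_algebra.intros)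
    then show ?thesis
      by (simp add: d_def inner_diff_left)
  qed
  ultimately have "\<exists>f'. (\<forall>x. ((\<lambda>x. complex_of_real (flat k (r x))) has_derivative f' x) (at x))
      \<and> (\<forall>b. (\<lambda>x. f' x b) \<in> bump_algebra a e)"
    by (intro exI[of _ "\<lambda>x h. of_real (d x * (- 2 * ((x - a) \<bullet> h)))"]) auto
  then show ?case
    unfolding r_def .
next
  case (add f g)
  then obtain f' g' where "\<And>x. (f has_derivative f' x) (at x)" "\<And>b. (\<lambda>x. f' x b) \<in> bump_algebra a e"
      "\<And>x. (g has_derivative g' x) (at x)" "\<And>b. (\<lambda>x. g' x b) \<in> bump_algebra a e"
    by blast
  then show ?case
    by (intro exI[of _ "\<lambda>x h. f' x h + g' x h"]) (auto intro: has_derivative_add bump_algebra.add)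
next
  case (mult f g)
  then obtain f' g' where "\<And>x. (f has_derivative f' x) (at x)" "\<And>b. (\<lambda>x. f' x b) \<in> bump_algebra a e"
      "\<And>x. (g has_derivative g' x) (at x)" "\<And>b. (\<lambda>x. g' x b) \<in> bump_algebra a e"
    by blast
  with mult.hyps show ?case
    by (intro exI[of _ "\<lambda>x h. f x * g' x h + f' x h * g x"])
       (auto intro!: has_derivative_mult bump_algebra.add bump_algebra.mult)
qed

lemma bump_algebra_smooth:
  assumes "f \<in> bump_algebra a e"
  shows "smooth_on UNIV f"
proof -
  have "partials bs f \<in> bump_algebra a e" for bs
  proof (induction bs)
    case (Cons b bs)
    then obtain f' where "\<And>x. (partials bs f has_derivative f' x) (at x)" "\<And>b. (\<lambda>x. f' x b) \<in> bump_algebra a e"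
      using bump_algebra_derivative by blast
    then have "frechet_derivative (partials bs f) (at x) = f' x" for x
      by (intro frechet_derivative_at[symmetric])
    then show ?case
      using \<open>(\<lambda>x. f' x b) \<in> bump_algebra a e\<close> by simp
  qed (simp add: assms)
  then show ?thesis
    using bump_algebra_derivative unfolding smooth_on_def differentiable_def by blast
qed

definition bump :: "'a::euclidean_space \<Rightarrow> real \<Rightarrow> 'a \<Rightarrow> real" where
  "bump a e x = flat 0 (e\<^sup>2 - (x - a) \<bullet> (x - a))"

lemma bump_nonneg: "0 \<le> bump a e x"
  by (simp add: bump_def flat_def)

lemma bump_pos_iff:
  assumes "0 < e"
  shows "0 < bump a e x \<longleftrightarrow> x \<in> ball a e"
proof -
  have "0 < e\<^sup>2 - (x - a) \<bullet> (x - a) \<longleftrightarrow> (norm (x - a))\<^sup>2 < e\<^sup>2"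
    by (simp add: power2_norm_eq_inner)
  also have "\<dots> \<longleftrightarrow> x \<in> ball a e"
    using assms by (auto simp: dist_norm norm_minus_commute power_strict_mono dest: power2_less_imp_less)
  finally show ?thesis
    by (simp add: bump_def flat_def)
qed

lemma supp_bump:
  assumes "0 < e"
  shows "supp (\<lambda>x. complex_of_real (bump a e x)) \<subseteq> cball a e"
  unfolding supp_def
proof (rule closure_minimal)
  have "bump a e x \<noteq> 0 \<Longrightarrow> x \<in> ball a e" for x
    using bump_pos_iff[OF assms, of a x] bump_nonneg[of a e x] by linarith
  then show "{x. complex_of_real (bump a e x) \<noteq> 0} \<subseteq> cball a e"
    using ball_subset_cball by fastforce
qed simp

lemma test_function_bump:
  assumes "0 < e"
  shows "test_function (\<lambda>x. complex_of_real (bump a e x))"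
proof -
  have "closed (supp (\<lambda>x. complex_of_real (bump a e x)))"
    by (simp add: supp_def)
  then have "compact (supp (\<lambda>x. complex_of_real (bump a e x)))"
    using compact_Int_closed[OF compact_cball] supp_bump[OF assms] by (metis inf.absorb_iff2)
  moreover have "smooth_on UNIV (\<lambda>x. complex_of_real (bump a e x))"
    unfolding bump_def by (rule bump_algebra_smooth[OF bump_algebra.flat])
  ultimately show ?thesis
    by (simp add: test_function_def)
qed

lemma continuous_bump: "continuous_on S (bump a e)"
proof -
  have "isCont (flat 0) t" for t
    using flat_has_derivative DERIV_isCont by blast
  then have "continuous_on UNIV (flat 0)"
    by (simp add: continuous_at_imp_continuous_on)
  then show ?thesis
    unfolding bump_def[abs_def] by (rule continuous_on_compose2) (auto intro!: continuous_intros)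
qed

text \<open>The fundamental lemma of the calculus of variations: if \<open>h a\<close> were nonzero,
  a bump on a small ball around \<open>a\<close> would have a nonzero integral against
  \<open>h\<close>.\<close>

lemma continuous_on_zero_if_orthogonal:
  fixes h :: "'a::euclidean_space \<Rightarrow> complex"
  assumes U: "open U" and h: "continuous_on U h"
    and orth: "\<And>\<phi>. test_function \<phi> \<Longrightarrow> supp \<phi> \<subseteq> U \<Longrightarrow> (LINT x|lborel. h x * \<phi> x) = 0"
    and a: "a \<in> U"
  shows "h a = 0"
proof (rule ccontr)
  assume nz: "h a \<noteq> 0"
  \<comment> \<open>Multiplying by \<open>cnj (h a)\<close> rotates \<open>h\<close> so that its
    value at \<open>a\<close> becomes the squared modulus of \<open>h a\<close>, which is
    positive.\<close>
  define g where "g x = Re (cnj (h a) * h x)" for x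
  have g: "continuous_on U g"
    unfolding g_def[abs_def] using h by (intro continuous_intros)
  have "0 < g a"
    using nz by (simp add: g_def mult.commute[of "cnj _"] complex_mult_cnj)
      (simp add: complex_eq_iff sum_power2_gt_zero_iff)
  then have "a \<in> U \<inter> g -` {0<..}"
    using a by simp
  moreover have "open (U \<inter> g -` {0<..})"
    using continuous_open_preimage[OF g U open_greaterThan] .
  ultimately obtain e where e: "0 < e" "cball a e \<subseteq> U \<inter> g -` {0<..}"
    using open_contains_cball[of "U \<inter> g -` {0<..}"] by blast
  then have e': "cball a e \<subseteq> U" "\<And>x. x \<in> cball a e \<Longrightarrow> 0 < g x"
    by auto
  have int: "integrable lborel (\<lambda>x. h x * of_real (bump a e x))"
  proof -
    have "integrable lborel (\<lambda>x. indicator (cball a e) x *\<^sub>R (h x * of_real (bump a e x)))"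
      by (intro borel_integrable_compact compact_cball continuous_on_mult continuous_on_subset[OF h e'(1)]
          continuous_on_of_real continuous_bump)
    also have "(\<lambda>x. indicator (cball a e) x *\<^sub>R (h x * of_real (bump a e x))) = (\<lambda>x. h x * of_real (bump a e x))"
      using bump_pos_iff[OF e(1), of a] bump_nonneg[of a e]
      by (intro ext) (auto simp: indicator_def order_less_le dist_commute)
    finally show ?thesis .
  qed
  then have int': "integrable lborel (\<lambda>x. g x * bump a e x)"
    using integrable_Re[OF integrable_mult_right[OF int, of "cnj (h a)"]] by (simp add: g_def algebra_simps)
  have nonneg: "0 \<le> g x * bump a e x" for x
    using bump_pos_iff[OF e(1), of a x] bump_nonneg[of a e x] e'(2)[of x]
    by (cases "x \<in> ball a e") (auto simp: order_less_le)
  have g_bump: "g x * bump a e x = Re (cnj (h a) * (h x * of_real (bump a e x)))" for x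
    by (simp add: g_def algebra_simps)
  have "(LINT x|lborel. g x * bump a e x) = Re (LINT x|lborel. cnj (h a) * (h x * of_real (bump a e x)))"
    unfolding g_bump by (rule integral_Re[OF integrable_mult_right[OF int]])
  also have "(LINT x|lborel. cnj (h a) * (h x * of_real (bump a e x))) = 0"
    using orth[OF test_function_bump[OF e(1)] order_trans[OF supp_bump[OF e(1)] e'(1)]] by simp
  finally have "AE x in lborel. g x * bump a e x = 0"
    using integral_nonneg_eq_0_iff_AE[OF int'] nonneg by simp
  then have "AE x in lborel. x \<notin> ball a e"
  proof eventually_elim
    case (elim x)
    then show ?case
      using bump_pos_iff[OF e(1), of a x] e'(2)[of x] by auto
  qed
  then have "emeasure lborel (ball a e) = 0"
    by (subst (asm) AE_iff_measurable[of "ball a e"]) auto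
  then show False
    using e(1) open_not_negligible[of "ball a e"] negligible_iff_null_sets[of "ball a e"]
    by (auto simp: null_sets_def)
qed

section \<open>Kernels of type \<open>\<lambda>\<close>\<close>

text \<open>Basis vectors are eigenvectors of the dilation, so each iterated partial derivative of
  the composition is a constant times that of \<open>\<phi>\<close>, composed with the
  dilation.\<close>

lemma smooth_on_dil:
  fixes \<phi> :: "real ^ 'n::finite \<Rightarrow> 'b::real_normed_vector"
  assumes \<phi>: "smooth_on UNIV \<phi>"
  shows "smooth_on UNIV (\<lambda>x. \<phi> (dil \<nu> r x))"
proof -
  have d: "(dil \<nu> r has_derivative dil \<nu> r) (at x)" for x :: "real ^ 'n"
    by (intro linear_imp_has_derivative linear_dil)
  have der: "((\<lambda>x. c *\<^sub>R partials bs \<phi> (dil \<nu> r x)) has_derivative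
        (\<lambda>h. c *\<^sub>R frechet_derivative (partials bs \<phi>) (at (dil \<nu> r x)) (dil \<nu> r h))) (at x)"
    if "set bs \<subseteq> Basis" for bs c x
  proof -
    have "(partials bs \<phi> has_derivative frechet_derivative (partials bs \<phi>) (at (dil \<nu> r x))) (at (dil \<nu> r x))"
      using smooth_on_differentiable[OF \<phi> that] by (simp add: frechet_derivative_works)
    from has_derivative_scaleR_right[OF diff_chain_at[OF d this], of c] show ?thesis
      by (simp add: o_def)
  qed
  have "\<exists>c. partials bs (\<lambda>x. \<phi> (dil \<nu> r x)) = (\<lambda>x. c *\<^sub>R partials bs \<phi> (dil \<nu> r x))" if "set bs \<subseteq> Basis" for bs
    using that
  proof (induction bs)
    case Nil
    show ?case
      by (rule exI[of _ 1]) simp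
  next
    case (Cons b bs)
    then obtain c where c: "partials bs (\<lambda>x. \<phi> (dil \<nu> r x)) = (\<lambda>x. c *\<^sub>R partials bs \<phi> (dil \<nu> r x))"
      by auto
    obtain i where i: "b = axis i 1"
      using Cons.prems by (auto simp: Basis_vec_def)
    have b: "dil \<nu> r b = (r powr \<nu> i) *\<^sub>R b"
      by (simp add: vec_eq_iff i axis_def)
    have "partials (b # bs) (\<lambda>x. \<phi> (dil \<nu> r x)) x = (c * r powr \<nu> i) *\<^sub>R partials (b # bs) \<phi> (dil \<nu> r x)" for x
    proof -
      have "partials bs \<phi> differentiable at (dil \<nu> r x)"
        using smooth_on_differentiable[OF \<phi>] Cons.prems by simp
      then have "frechet_derivative (partials bs \<phi>) (at (dil \<nu> r x)) ((r powr \<nu> i) *\<^sub>R b)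
          = (r powr \<nu> i) *\<^sub>R frechet_derivative (partials bs \<phi>) (at (dil \<nu> r x)) b"
        by (intro linear_scale linear_frechet_derivative)
      moreover have "frechet_derivative (\<lambda>x. c *\<^sub>R partials bs \<phi> (dil \<nu> r x)) (at x) b
          = c *\<^sub>R frechet_derivative (partials bs \<phi>) (at (dil \<nu> r x)) (dil \<nu> r b)"
        using Cons.prems by (subst frechet_derivative_at[OF der, symmetric]) auto
      ultimately show ?thesis
        by (simp add: c b)
    qed
    then show ?case
      by blast
  qed
  then show ?thesis
    unfolding smooth_on_def using der by (metis differentiableI)
qed

lemma continuous_test_function: "test_function \<phi> \<Longrightarrow> continuous_on S \<phi>"
  using smooth_on_continuous[of UNIV \<phi> "[]"] continuous_on_subset by (auto simp: test_function_def)

lemma integrable_mult_test_function: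
  assumes h: "continuous_on U h" and \<phi>: "test_function \<phi>" "supp \<phi> \<subseteq> U"
  shows "integrable lborel (\<lambda>x. h x * \<phi> x)"
proof -
  have "integrable lborel (\<lambda>x. indicator (supp \<phi>) x *\<^sub>R (h x * \<phi> x))"
    using \<phi> by (intro borel_integrable_compact continuous_on_mult continuous_on_subset[OF h]
        continuous_test_function) (auto simp: test_function_def)
  also have "(\<lambda>x. indicator (supp \<phi>) x *\<^sub>R (h x * \<phi> x)) = (\<lambda>x. h x * \<phi> x)"
  proof
    fix x
    have "\<phi> x = 0" if "x \<notin> supp \<phi>"
      using that closure_subset[of "{x. \<phi> x \<noteq> 0}"] by (auto simp: supp_def)
    then show "indicator (supp \<phi>) x *\<^sub>R (h x * \<phi> x) = h x * \<phi> x"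
      by (auto simp: indicator_def)
  qed
  finally show ?thesis .
qed

lemma measurable_smooth_off_origin:
  fixes K :: "'a::euclidean_space \<Rightarrow> complex"
  assumes "smooth_on (- {0}) K"
  shows "K \<in> borel_measurable borel"
proof -
  have "continuous_on (- {0}) K"
    using smooth_on_continuous[OF assms, of "[]"] by simp
  then have "(\<lambda>x. if x \<in> - {0} then K x else K 0) \<in> borel_measurable borel"
    by (intro borel_measurable_continuous_on_if) auto
  then show ?thesis
    by (rule measurable_cong[THEN iffD1, rotated]) auto
qed

text \<open>Off the origin \<open>\<tau>\<close> is integration against the continuous function
  \<open>K\<close>. Hence both sides agree once they have the same integral against every test
  function supported there, and those integrals are governed by the homogeneity of
  \<open>\<tau>\<close>.\<close>

lemma kernel_homogeneous:
  fixes K :: "real ^ 'n::finite \<Rightarrow> complex"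
  assumes K: "kernel_of_type \<nu> lam \<tau> K" and r: "0 < r" and x: "x \<noteq> 0"
  shows "K (dil \<nu> r x) = of_real (r powr (lam - hom_dim \<nu>)) * K x"
proof -
  let ?c = "complex_of_real (r powr (lam - hom_dim \<nu>))"
  have sm: "smooth_on (- {0}) K"
    and rep: "\<And>\<phi>. test_function \<phi> \<Longrightarrow> 0 \<notin> supp \<phi> \<Longrightarrow> \<tau> \<phi> = (LINT x|lebesgue. K x * \<phi> x)"
    \<comment> \<open>In degree \<open>lam - hom_dim \<nu>\<close> the exponent
      \<open>- hom_dim \<nu> - \<mu>\<close> of the definition becomes \<open>- lam\<close>.\<close>
    and hom: "\<And>\<phi> r. test_function \<phi> \<Longrightarrow> 0 < r \<Longrightarrow> \<tau> (\<phi> \<circ> dil \<nu> r) = of_real (r powr - lam) * \<tau> \<phi>"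
    using K by (auto simp: kernel_of_type_def smooth_off_origin_def homogeneous_distribution_def)
  have [measurable]: "K \<in> borel_measurable borel"
    by (rule measurable_smooth_off_origin[OF sm])
  have cont: "continuous_on (- {0}) K"
    using smooth_on_continuous[OF sm, of "[]"] by simp
  have dcont: "continuous_on (- {0}) (\<lambda>x. K (dil \<nu> r x))"
    using r by (intro continuous_on_compose2[OF cont] continuous_intros) auto
  have "K (dil \<nu> r x) - ?c * K x = 0"
  proof (rule continuous_on_zero_if_orthogonal[where U = "- {0}" and a = x and h = "\<lambda>x. K (dil \<nu> r x) - ?c * K x"])
    fix \<phi> :: "real ^ 'n \<Rightarrow> complex"
    assume \<phi>: "test_function \<phi>" "supp \<phi> \<subseteq> - {0}"
    \<comment> \<open>As \<open>\<phi>\<close> is \<open>\<psi>\<close> composed with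
      \<open>dil \<nu> r\<close>, a substitution frees \<open>K\<close> from the dilation at the
      cost of \<open>r powr - hom_dim \<nu>\<close>; homogeneity of \<open>\<tau>\<close> at
      \<open>1 / r\<close> then contributes \<open>r powr lam\<close>.\<close>
    define \<psi> where "\<psi> = \<phi> \<circ> dil \<nu> (1 / r)"
    have \<psi>_dil: "\<psi> (dil \<nu> r y) = \<phi> y" for y
      using r by (simp add: \<psi>_def)
    have comp: "compact (dil \<nu> r ` supp \<phi>)"
      using \<phi> r by (intro compact_continuous_image continuous_intros) (auto simp: test_function_def)
    have supp: "supp \<psi> \<subseteq> dil \<nu> r ` supp \<phi>"
      unfolding supp_def[of \<psi>]
    proof (rule closure_minimal)
      show "{x. \<psi> x \<noteq> 0} \<subseteq> dil \<nu> r ` supp \<phi>"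
      proof
        fix y assume "y \<in> {x. \<psi> x \<noteq> 0}"
        then have "dil \<nu> (1 / r) y \<in> supp \<phi>"
          using closure_subset[of "{x. \<phi> x \<noteq> 0}"] by (auto simp: supp_def \<psi>_def)
        then show "y \<in> dil \<nu> r ` supp \<phi>"
          using r by (intro image_eqI[of _ _ "dil \<nu> (1 / r) y"]) auto
      qed
      show "closed (dil \<nu> r ` supp \<phi>)"
        using comp by (rule compact_imp_closed)
    qed
    have "closed (supp \<psi>)"
      by (simp add: supp_def)
    then have "compact (supp \<psi>)"
      using comp supp by (metis compact_Int_closed inf.absorb_iff2)
    then have \<psi>: "test_function \<psi>"
      using \<phi> smooth_on_dil[of \<phi> \<nu> "1 / r"] by (simp add: test_function_def \<psi>_def o_def)
    have \<psi>0: "0 \<notin> supp \<psi>"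
      using supp \<phi> r by force
    have [measurable]: "\<phi> \<in> borel_measurable borel" "\<psi> \<in> borel_measurable borel"
      using \<phi> \<psi> by (auto intro: borel_measurable_continuous_onI continuous_test_function)
    have "(LINT y|lborel. K (dil \<nu> r y) * \<phi> y) = (LINT y|lborel. (\<lambda>x. K x * \<psi> x) (dil \<nu> r y))"
      by (simp add: \<psi>_dil)
    also have "\<dots> = (LINT x|distr lborel borel (dil \<nu> r). K x * \<psi> x)"
      by (subst integral_distr) auto
    also have "\<dots> = of_real (r powr - hom_dim \<nu>) * (LINT x|lborel. K x * \<psi> x)"
      by (simp add: distr_dil[OF r] integral_density scaleR_conv_of_real)
    also have "(LINT x|lborel. K x * \<psi> x) = \<tau> \<psi>"
      using rep[OF \<psi> \<psi>0] by (simp add: integral_completion)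
    also have "\<tau> \<psi> = of_real (r powr lam) * \<tau> \<phi>"
      using hom[OF \<phi>(1), of "1 / r"] r by (simp add: \<psi>_def powr_divide powr_minus)
    also have "\<tau> \<phi> = (LINT x|lborel. K x * \<phi> x)"
      using rep[OF \<phi>(1)] \<phi>(2) by (auto simp: integral_completion)
    finally have "(LINT y|lborel. K (dil \<nu> r y) * \<phi> y) = ?c * (LINT x|lborel. K x * \<phi> x)"
      using r by (simp add: powr_diff powr_minus field_simps flip: of_real_mult)
    moreover have "(LINT x|lborel. (K (dil \<nu> r x) - ?c * K x) * \<phi> x)
        = (LINT y|lborel. K (dil \<nu> r y) * \<phi> y) - ?c * (LINT x|lborel. K x * \<phi> x)"
      using integrable_mult_test_function[OF dcont \<phi>] integrable_mult_test_function[OF cont \<phi>]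
      by (simp add: left_diff_distrib mult.assoc)
    ultimately show "(LINT x|lborel. (K (dil \<nu> r x) - ?c * K x) * \<phi> x) = 0"
      by simp
  qed (use x cont dcont in \<open>auto intro!: continuous_intros\<close>)
  then show ?thesis
    by simp
qed

section \<open>Differentiation along one-parameter subgroups\<close>

text \<open>One continuous derivative suffices for each use: first differences differentiate
  \<open>K\<close> once, second differences differentiate the Lie derivatives of \<open>K\<close>
  once.\<close>

definition C1_on :: "'a::euclidean_space set \<Rightarrow> ('a \<Rightarrow> 'b::real_normed_vector) \<Rightarrow> bool" where
  "C1_on S h \<longleftrightarrow> (\<forall>x\<in>S. h differentiable (at x)) \<and>
     (\<forall>b\<in>Basis. continuous_on S (\<lambda>x. frechet_derivative h (at x) b))"

lemma C1_onI:
  assumes "\<And>x. x \<in> S \<Longrightarrow> (h has_derivative h' x) (at x)" "\<And>b. b \<in> Basis \<Longrightarrow> continuous_on S (\<lambda>x. h' x b)"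
  shows "C1_on S h"
proof -
  have "frechet_derivative h (at x) = h' x" if "x \<in> S" for x
    using assms(1)[OF that] by (rule frechet_derivative_at[symmetric])
  then have "continuous_on S (\<lambda>x. frechet_derivative h (at x) b)" if "b \<in> Basis" for b
    using assms(2)[OF that] by (simp cong: continuous_on_cong)
  then show ?thesis
    using assms(1) by (auto simp: C1_on_def differentiable_def)
qed

lemma C1_onD:
  assumes "C1_on S h"
  shows C1_on_derivative: "x \<in> S \<Longrightarrow> (h has_derivative frechet_derivative h (at x)) (at x)"
    and C1_on_continuous_derivative: "b \<in> Basis \<Longrightarrow> continuous_on S (\<lambda>x. frechet_derivative h (at x) b)"
    and C1_on_continuous: "continuous_on S h"
  using assms
  by (auto simp: C1_on_def frechet_derivative_works[symmetric]
      intro: continuous_at_imp_continuous_on differentiable_imp_continuous_within)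

lemma C1_on_partials:
  assumes "smooth_on S f" "set bs \<subseteq> Basis"
  shows "C1_on S (partials bs f)"
  unfolding C1_on_def
  using smooth_on_differentiable[OF assms] smooth_on_continuous[OF assms(1), of "b # bs" for b] assms(2)
  by simp

lemma C1_on_scaleR:
  assumes f: "C1_on S f" and g: "C1_on S g"
  shows "C1_on S (\<lambda>x. f x *\<^sub>R g x)"
proof (rule C1_onI)
  show "((\<lambda>x. f x *\<^sub>R g x) has_derivative
      (\<lambda>h. f x *\<^sub>R frechet_derivative g (at x) h + frechet_derivative f (at x) h *\<^sub>R g x)) (at x)" if "x \<in> S" for x
    using that by (intro has_derivative_scaleR C1_on_derivative[OF f] C1_on_derivative[OF g])
qed (intro continuous_intros C1_on_continuous[OF f] C1_on_continuous[OF g]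
    C1_on_continuous_derivative[OF f] C1_on_continuous_derivative[OF g])

lemma C1_on_sum:
  assumes "\<And>i. i \<in> I \<Longrightarrow> C1_on S (f i)"
  shows "C1_on S (\<lambda>x. \<Sum>i\<in>I. f i x)"
proof (rule C1_onI)
  show "((\<lambda>x. \<Sum>i\<in>I. f i x) has_derivative (\<lambda>h. \<Sum>i\<in>I. frechet_derivative (f i) (at x) h)) (at x)" if "x \<in> S" for x
    using that by (intro has_derivative_sum C1_on_derivative[OF assms])
qed (intro continuous_intros C1_on_continuous_derivative[OF assms])

lemma linear_expand_axis:
  assumes "linear (f :: real ^ 'n::finite \<Rightarrow> 'b::real_vector)"
  shows "f x = (\<Sum>i\<in>UNIV. x $ i *\<^sub>R f (axis i 1))"
proof -
  have "x = (\<Sum>i\<in>UNIV. x $ i *\<^sub>R axis i 1)"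
    by (simp add: vec_eq_iff axis_def if_distrib cong: if_cong)
  then have "f x = f (\<Sum>i\<in>UNIV. x $ i *\<^sub>R axis i 1)"
    by simp
  then show ?thesis
    using assms by (simp add: linear_sum linear_scale)
qed

context homogeneous_group
begin

section \<open>Left-invariant vector fields\<close>

text \<open>The differential at the origin of the left translation by \<open>v\<close>, that is, the
  value at \<open>v\<close> of the left-invariant vector field equal to \<open>z\<close> at the
  origin.\<close>

definition right_derivative :: "real ^ 'n \<Rightarrow> real ^ 'n \<Rightarrow> real ^ 'n" where
  "right_derivative v z = frechet_derivative uncurried_mul (at (v, 0)) (0, z)"

lemma mul_right_has_derivative: "(mul v has_derivative right_derivative v) (at 0)"
proof -
  have "((\<lambda>z. (v, z)) has_derivative (\<lambda>h. (0, h))) (at 0)"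
    by (auto intro!: derivative_eq_intros)
  from diff_chain_at[OF this mul_has_derivative] show ?thesis
    by (simp add: o_def right_derivative_def[abs_def])
qed

text \<open>The coefficients of a left-invariant field are first partial derivatives of the smooth
  product at the points \<open>(v, 0)\<close>, and these can be differentiated once more.\<close>

lemma C1_on_right_derivative: "C1_on S (\<lambda>v. right_derivative v (axis i 1) $ j)"
proof -
  let ?M = "partials [(0, axis i 1)] uncurried_mul"
  have M: "C1_on UNIV ?M"
    by (intro C1_on_partials[OF smooth_mul]) (auto simp: Basis_prod_def axis_in_Basis_iff)
  have "((\<lambda>v. right_derivative v (axis i 1) $ j) has_derivative
      (\<lambda>h. frechet_derivative ?M (at (v, 0)) (h, 0) $ j)) (at v)" for v
  proof -
    have "((\<lambda>v. (v, 0)) has_derivative (\<lambda>h. (h, 0))) (at v)"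
      by (auto intro!: derivative_eq_intros)
    from diff_chain_at[OF this C1_on_derivative[OF M UNIV_I]]
    have "((\<lambda>v. ?M (v, 0)) has_derivative (\<lambda>h. frechet_derivative ?M (at (v, 0)) (h, 0))) (at v)"
      by (simp add: o_def)
    from bounded_linear.has_derivative[OF bounded_linear_vec_nth this] show ?thesis
      by (simp add: right_derivative_def)
  qed
  moreover have "continuous_on S (\<lambda>v. frechet_derivative ?M (at (v, 0)) (b, 0) $ j)" if "b \<in> Basis" for b
    using that
    by (intro continuous_on_component
        continuous_on_compose2[OF C1_on_continuous_derivative[OF M, of "(b, 0)"]] continuous_intros)
       (auto simp: Basis_prod_def)
  ultimately show ?thesis
    by (rule C1_onI)
qed

text \<open>The left-invariant field of the i-th basis vector applied to \<open>h\<close>, in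
  coordinates.\<close>

definition lie_derivative :: "(real ^ 'n \<Rightarrow> complex) \<Rightarrow> 'n \<Rightarrow> real ^ 'n \<Rightarrow> complex" where
  "lie_derivative h i v =
     (\<Sum>j\<in>UNIV. right_derivative v (axis i 1) $ j *\<^sub>R frechet_derivative h (at v) (axis j 1))"

text \<open>As \<open>t \<mapsto> t z\<close> is a one-parameter subgroup, moving from time
  \<open>t\<close> to \<open>s\<close> is right multiplication by \<open>(s - t) z\<close>. Thus the
  derivative at any time reduces to \<open>right_derivative\<close> at the current point.\<close>

lemma has_derivative_along_subgroup:
  assumes h: "h differentiable (at (mul u (t *\<^sub>R z)))"
  shows "((\<lambda>t. h (mul u (t *\<^sub>R z))) has_vector_derivative
    (\<Sum>i\<in>UNIV. z $ i *\<^sub>R lie_derivative h i (mul u (t *\<^sub>R z)))) (at t)"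
proof -
  define v where "v = mul u (t *\<^sub>R z)"
  let ?h' = "frechet_derivative h (at v)"
  have h': "(h has_derivative ?h') (at (mul v 0))"
    using h by (simp add: v_def frechet_derivative_works)
  have lh: "linear ?h'"
    using h by (simp add: v_def linear_frechet_derivative)
  have lr: "linear (right_derivative v)"
    using mul_right_has_derivative has_derivative_linear by blast
  have "((\<lambda>s. (s - t) *\<^sub>R z) has_derivative (\<lambda>s. s *\<^sub>R z)) (at t)"
    by (auto intro!: derivative_eq_intros)
  from diff_chain_at[OF this] mul_right_has_derivative[of v]
  have "((\<lambda>s. mul v ((s - t) *\<^sub>R z)) has_derivative (\<lambda>s. right_derivative v (s *\<^sub>R z))) (at t)"
    by (simp add: o_def)
  from diff_chain_at[OF this, of h ?h'] h'
  have "((\<lambda>s. h (mul v ((s - t) *\<^sub>R z))) has_derivative (\<lambda>s. ?h' (right_derivative v (s *\<^sub>R z)))) (at t)"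
    by (simp add: o_def)
  moreover have "mul v ((s - t) *\<^sub>R z) = mul u (s *\<^sub>R z)" for s
    by (simp add: v_def assoc one_param)
  moreover have "?h' (right_derivative v (s *\<^sub>R z)) = s *\<^sub>R (\<Sum>i\<in>UNIV. z $ i *\<^sub>R lie_derivative h i v)" for s
  proof -
    have "right_derivative v (s *\<^sub>R z) = s *\<^sub>R (\<Sum>i\<in>UNIV. z $ i *\<^sub>R right_derivative v (axis i 1))"
      using lr linear_expand_axis[OF lr, of z] by (simp add: linear_scale)
    moreover have "?h' (right_derivative v (axis i 1)) = lie_derivative h i v" for i
      unfolding lie_derivative_def by (rule linear_expand_axis[OF lh])
    ultimately show ?thesis
      using lh by (simp add: linear_scale linear_sum)
  qed
  ultimately show ?thesis
    by (simp add: has_vector_derivative_def v_def)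
qed

lemma continuous_lie_derivative:
  assumes "C1_on S h"
  shows "continuous_on S (lie_derivative h i)"
  unfolding lie_derivative_def[abs_def]
  by (intro continuous_intros C1_on_continuous C1_on_right_derivative
      C1_on_continuous_derivative[OF assms]) (simp add: axis_in_Basis_iff)

lemma C1_lie_derivative:
  assumes "smooth_on S h"
  shows "C1_on S (lie_derivative h i)"
proof -
  have "C1_on S (\<lambda>v. \<Sum>j\<in>UNIV. right_derivative v (axis i 1) $ j *\<^sub>R partials [axis j 1] h v)"
    by (intro C1_on_sum C1_on_scaleR C1_on_right_derivative C1_on_partials[OF assms])
       (auto simp: axis_in_Basis_iff)
  then show ?thesis
    by (simp add: lie_derivative_def[abs_def])
qed

end

lemma norm_increment_le:
  fixes g :: "real \<Rightarrow> 'a::real_normed_vector"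
  assumes der: "\<And>t. t \<in> {0..1} \<Longrightarrow> (g has_vector_derivative g' t) (at t)"
    and le: "\<And>t. t \<in> {0..1} \<Longrightarrow> norm (g' t) \<le> B"
  shows "norm (g 1 - g 0) \<le> B"
proof -
  have "norm (g 1 - g 0) \<le> B * norm (1 - 0 :: real)"
  proof (rule differentiable_bound[where S = "{0..1}"])
    fix t :: real assume t: "t \<in> {0..1}"
    show "(g has_derivative (\<lambda>s. s *\<^sub>R g' t)) (at t within {0..1})"
      using der[OF t] has_derivative_at_withinI by (auto simp: has_vector_derivative_def)
    show "onorm (\<lambda>s. s *\<^sub>R g' t) \<le> B"
      using le[OF t] by (intro onorm_le) (simp add: mult.commute[of B] mult_left_mono)
  qed auto
  then show ?thesis
    by simp
qed

context homogeneous_group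
begin

text \<open>The mean value inequality along \<open>t \<mapsto> u (t z)\<close>. The derivative is
  linear in \<open>z\<close>; its coefficients are Lie derivatives of \<open>h\<close>, bounded on
  the compact set of products \<open>mul u z\<close>, which avoids the origin.\<close>

lemma difference_along_subgroup_le:
  fixes h :: "real ^ 'n \<Rightarrow> complex"
  assumes h: "C1_on (- {0}) h" and A: "compact A"
    and nz: "\<And>u z. u \<in> A \<Longrightarrow> norm z \<le> d \<Longrightarrow> mul u z \<noteq> 0"
  shows "\<exists>C\<ge>0. \<forall>u\<in>A. \<forall>z. norm z \<le> d \<longrightarrow> norm (h (mul u z) - h u) \<le> C * norm z"
proof -
  define M where "M = (\<lambda>(u, z). mul u z) ` (A \<times> cball 0 d)"
  have M: "compact M" "M \<subseteq> - {0}"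
    unfolding M_def using A nz
    by (auto intro!: compact_continuous_image compact_Times continuous_intros simp: case_prod_unfold)
  have "\<exists>B. \<forall>v\<in>M. norm (lie_derivative h i v) \<le> B" for i
  proof -
    have "compact (lie_derivative h i ` M)"
      using M by (intro compact_continuous_image continuous_on_subset[OF continuous_lie_derivative[OF h]])
    then show ?thesis
      using compact_imp_bounded bounded_iff by (metis imageI)
  qed
  then obtain B where B: "\<And>i v. v \<in> M \<Longrightarrow> norm (lie_derivative h i v) \<le> B i"
    by metis
  define C where "C = (\<Sum>i\<in>UNIV. \<bar>B i\<bar>)"
  have "norm (h (mul u z) - h u) \<le> C * norm z" if u: "u \<in> A" and z: "norm z \<le> d" for u z
  proof -
    let ?g' = "\<lambda>t. \<Sum>i\<in>UNIV. z $ i *\<^sub>R lie_derivative h i (mul u (t *\<^sub>R z))"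
    have in_M: "mul u (t *\<^sub>R z) \<in> M" if "t \<in> {0..1}" for t
    proof -
      have "norm (t *\<^sub>R z) \<le> 1 * d"
        using that z unfolding norm_scaleR by (intro mult_mono) auto
      then show ?thesis
        unfolding M_def using u by (intro image_eqI[of _ _ "(u, t *\<^sub>R z)"]) auto
    qed
    have "norm (h (mul u (1 *\<^sub>R z)) - h (mul u (0 *\<^sub>R z))) \<le> C * norm z"
    proof (rule norm_increment_le[where g = "\<lambda>t. h (mul u (t *\<^sub>R z))" and g' = ?g'])
      fix t :: real assume t: "t \<in> {0..1}"
      have "h differentiable (at (mul u (t *\<^sub>R z)))"
        using h M(2) in_M[OF t] by (auto simp: C1_on_def)
      then show "((\<lambda>t. h (mul u (t *\<^sub>R z))) has_vector_derivative ?g' t) (at t)"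
        by (rule has_derivative_along_subgroup)
      have "norm (?g' t) \<le> (\<Sum>i\<in>UNIV. \<bar>z $ i\<bar> * norm (lie_derivative h i (mul u (t *\<^sub>R z))))"
        by (rule order_trans[OF norm_sum]) simp
      also have "\<dots> \<le> (\<Sum>i\<in>UNIV. norm z * \<bar>B i\<bar>)"
        using B[OF in_M[OF t]] by (intro sum_mono mult_mono component_le_norm_cart)
          (auto intro: order_trans[OF _ abs_ge_self])
      also have "\<dots> = C * norm z"
        by (simp add: C_def sum_distrib_left mult.commute)
      finally show "norm (?g' t) \<le> C * norm z" .
    qed
    then show ?thesis
      by simp
  qed
  moreover have "0 \<le> C"
    by (simp add: C_def sum_nonneg)
  ultimately show ?thesis
    by blast
qed

text \<open>Each Lie derivative of \<open>h\<close> is again \<open>C\<^sup>1\<close>, so that the derivative of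
  \<open>t \<mapsto> h (u (t z)) + h (u (- t z))\<close> is a sum of first differences.\<close>

lemma second_difference_along_subgroup_le:
  fixes h :: "real ^ 'n \<Rightarrow> complex"
  assumes h: "smooth_on (- {0}) h" and A: "compact A"
    and nz: "\<And>u z. u \<in> A \<Longrightarrow> norm z \<le> d \<Longrightarrow> mul u z \<noteq> 0"
  shows "\<exists>C\<ge>0. \<forall>u\<in>A. \<forall>z. norm z \<le> d \<longrightarrow>
    norm (h (mul u z) + h (mul u (- z)) - 2 * h u) \<le> C * norm z ^ 2"
proof -
  have "\<exists>C\<ge>0. \<forall>u\<in>A. \<forall>z. norm z \<le> d \<longrightarrow>
      norm (lie_derivative h i (mul u z) - lie_derivative h i u) \<le> C * norm z" for i
    by (intro difference_along_subgroup_le C1_lie_derivative h A nz)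
  then obtain B where B: "\<And>i. 0 \<le> B i" "\<And>i u z. u \<in> A \<Longrightarrow> norm z \<le> d \<Longrightarrow>
      norm (lie_derivative h i (mul u z) - lie_derivative h i u) \<le> B i * norm z"
    by metis
  define C where "C = (\<Sum>i\<in>UNIV. 2 * B i)"
  have "norm (h (mul u z) + h (mul u (- z)) - 2 * h u) \<le> C * norm z ^ 2"
    if u: "u \<in> A" and z: "norm z \<le> d" for u z
  proof -
    define G where "G t = h (mul u (t *\<^sub>R z)) + h (mul u (t *\<^sub>R (- z)))" for t
    let ?D = "\<lambda>t i. lie_derivative h i (mul u (t *\<^sub>R z)) - lie_derivative h i (mul u (t *\<^sub>R (- z)))"
    have "norm (G 1 - G 0) \<le> C * norm z ^ 2"
    proof (rule norm_increment_le[where g' = "\<lambda>t. \<Sum>i\<in>UNIV. z $ i *\<^sub>R ?D t i"])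
      fix t :: real assume t: "t \<in> {0..1}"
      have tz: "norm (t *\<^sub>R z) \<le> norm z" "norm (t *\<^sub>R (- z)) \<le> norm z"
        using t by (auto simp: mult_left_le_one_le)
      have "h differentiable (at (mul u w))" if "norm w \<le> d" for w
        using smooth_on_differentiable[OF h, of "[]" "mul u w"] nz[OF u that] by simp
      then have d: "h differentiable (at (mul u (t *\<^sub>R z)))" "h differentiable (at (mul u (t *\<^sub>R (- z))))"
        using tz z by auto
      show "(G has_vector_derivative (\<Sum>i\<in>UNIV. z $ i *\<^sub>R ?D t i)) (at t)"
        using has_vector_derivative_add[OF has_derivative_along_subgroup[OF d(1)] has_derivative_along_subgroup[OF d(2)]]
        unfolding G_def[abs_def] by (simp add: sum_negf scaleR_diff_right sum_subtractf)
      have D: "norm (?D t i) \<le> 2 * B i * norm z" for i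
      proof -
        \<comment> \<open>Both values are compared with the one at \<open>u\<close>, where the bound
          on first differences applies; hence the factor 2 in \<open>C\<close>.\<close>
        have "norm (?D t i) = norm ((lie_derivative h i (mul u (t *\<^sub>R z)) - lie_derivative h i u)
            - (lie_derivative h i (mul u (t *\<^sub>R (- z))) - lie_derivative h i u))"
          by simp
        also have "\<dots> \<le> B i * norm (t *\<^sub>R z) + B i * norm (t *\<^sub>R (- z))"
          using tz z u by (intro norm_triangle_le_diff add_mono B(2)) auto
        also have "\<dots> \<le> B i * norm z + B i * norm z"
          using tz B(1) by (intro add_mono mult_left_mono) auto
        finally show ?thesis by simp
      qed
      have "norm (\<Sum>i\<in>UNIV. z $ i *\<^sub>R ?D t i) \<le> (\<Sum>i\<in>UNIV. \<bar>z $ i\<bar> * norm (?D t i))"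
        by (rule order_trans[OF norm_sum]) simp
      also have "\<dots> \<le> (\<Sum>i\<in>UNIV. norm z * (2 * B i * norm z))"
        by (intro sum_mono mult_mono component_le_norm_cart D) auto
      also have "\<dots> = C * norm z ^ 2"
        by (simp add: C_def sum_distrib_left sum_distrib_right power2_eq_square mult_ac)
      finally show "norm (\<Sum>i\<in>UNIV. z $ i *\<^sub>R ?D t i) \<le> C * norm z ^ 2" .
    qed
    then show ?thesis
      by (simp add: G_def)
  qed
  moreover have "0 \<le> C"
    using B(1) by (simp add: C_def sum_nonneg)
  ultimately show ?thesis
    by blast
qed

text \<open>The increment acts on the right, so a left translation passes through it by
  associativity.\<close>

lemma lip_diff_translate: "lip_diff mul \<alpha> (\<lambda>u. h (mul w u)) x y = lip_diff mul \<alpha> h (mul w x) y"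
  by (simp add: lip_diff_def assoc)

end

context quasi_normed_group
begin

section \<open>Decay of differences of the kernel\<close>

text \<open>Write \<open>z = dil \<nu> (N z) w\<close> with \<open>w\<close> in the compact unit
  ball of \<open>N\<close>. Coordinate \<open>i\<close> carries the factor
  \<open>N z powr \<nu> i\<close>, at most \<open>N z powr s\<close> because
  \<open>N z \<le> 1\<close>.\<close>

lemma norm_le_N_powr:
  assumes s: "\<And>i. s \<le> \<nu> i"
  shows "\<exists>C\<ge>0. \<forall>z. N z \<le> 1 \<longrightarrow> norm z \<le> C * N z powr s"
proof -
  obtain M where M: "\<And>w. N w \<le> 1 \<Longrightarrow> norm w \<le> M"
    using compact_imp_bounded[OF compact_N_le[of 1]] by (auto simp: bounded_iff)
  have "0 \<le> M"
    using M[of 0] by simp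
  have "norm z \<le> (real CARD('n) * M) * N z powr s" if z: "N z \<le> 1" for z
  proof (cases "z = 0")
    case False
    then have r: "0 < N z"
      by simp
    define w where "w = dil \<nu> (1 / N z) z"
    have w: "N w \<le> 1"
      using r by (simp add: w_def N_dil)
    have zw: "z = dil \<nu> (N z) w"
      using r by (simp add: w_def)
    have "norm z \<le> (\<Sum>i\<in>UNIV. \<bar>z $ i\<bar>)"
      by (rule norm_le_l1_cart)
    also have "\<dots> \<le> (\<Sum>i\<in>(UNIV :: 'n set). N z powr s * M)"
    proof (rule sum_mono)
      fix i
      have "\<bar>z $ i\<bar> = N z powr \<nu> i * \<bar>w $ i\<bar>"
        by (subst zw) (simp add: abs_mult)
      also have "\<dots> \<le> N z powr s * M"
        using r z s[of i] component_le_norm_cart[of w i] M[OF w]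
        by (intro mult_mono powr_mono') auto
      finally show "\<bar>z $ i\<bar> \<le> N z powr s * M" .
    qed
    finally show ?thesis
      by (simp add: mult_ac)
  qed simp
  moreover have "0 \<le> real CARD('n) * M"
    using \<open>0 \<le> M\<close> by simp
  ultimately show ?thesis
    by blast
qed

text \<open>A vanishing product forces \<open>z = - u\<close> and thus \<open>N z = N u = 1\<close>,
  which continuity of \<open>N\<close> at the origin excludes for small \<open>z\<close>.\<close>

lemma mul_nonzero_near_unit_sphere: "\<exists>d>0. \<forall>u z. N u = 1 \<longrightarrow> norm z \<le> d \<longrightarrow> mul u z \<noteq> 0"
proof -
  have "isCont N 0"
    using N_continuous[of UNIV] by (simp add: continuous_on_eq_continuous_at)
  then obtain d where d: "0 < d" "\<And>z. dist z 0 < d \<Longrightarrow> dist (N z) (N 0) < 1"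
    unfolding continuous_at_eps_delta by (metis zero_less_one)
  have "mul u z \<noteq> 0" if "N u = 1" "norm z \<le> d / 2" for u z
  proof
    assume "mul u z = 0"
    then have "N z = 1"
      using that by (simp add: mul_eq_0_iff)
    then show False
      using d(2)[of z] d(1) that by simp
  qed
  then show ?thesis
    using d(1) by (intro exI[of _ "d / 2"]) auto
qed

text \<open>The power of \<open>norm z\<close> gained by a difference with increment
  \<open>z\<close>.\<close>

definition diff_order :: "real \<Rightarrow> nat" where
  "diff_order \<alpha> = (if \<alpha> = 1 then 2 else 1)"

lemma lip_diff_near_unit_sphere_le:
  assumes K: "smooth_on (- {0}) K"
  shows "\<exists>d>0. \<exists>C\<ge>0. \<forall>u z. N u = 1 \<longrightarrow> norm z \<le> d \<longrightarrow>
    mul u z \<noteq> 0 \<and> norm (lip_diff mul \<alpha> K u z) \<le> C * norm z ^ diff_order \<alpha>"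
proof -
  obtain d where d: "0 < d" "\<And>u z. N u = 1 \<Longrightarrow> norm z \<le> d \<Longrightarrow> mul u z \<noteq> 0"
    using mul_nonzero_near_unit_sphere by blast
  have "closed {u. N u = 1}"
    by (intro closed_Collect_eq continuous_intros)
  moreover have "{u. N u = 1} = {u. N u \<le> 1} \<inter> {u. N u = 1}"
    by auto
  ultimately have A: "compact {u. N u = 1}"
    using compact_Int_closed[OF compact_N_le[of 1]] by metis
  have "\<exists>C\<ge>0. \<forall>u\<in>{u. N u = 1}. \<forall>z. norm z \<le> d \<longrightarrow> norm (lip_diff mul \<alpha> K u z) \<le> C * norm z ^ diff_order \<alpha>"
  proof (cases "\<alpha> = 1")
    case True
    show ?thesis
      unfolding lip_diff_def diff_order_def if_P[OF True]
      using d(2) by (intro second_difference_along_subgroup_le K A) auto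
  next
    case False
    show ?thesis
      unfolding lip_diff_def diff_order_def if_not_P[OF False] power_one_right
      using d(2) C1_on_partials[OF K, of "[]"] by (intro difference_along_subgroup_le A) auto
  qed
  then show ?thesis
    using d by blast
qed

text \<open>\<open>K 0\<close> is arbitrary, so homogeneity is available only at evaluation points
  other than the origin.\<close>

lemma lip_diff_dil:
  assumes hom: "\<And>r x. 0 < r \<Longrightarrow> x \<noteq> 0 \<Longrightarrow> K (dil \<nu> r x) = of_real (r powr s) * K x"
    and r: "0 < r" and nz: "u \<noteq> 0" "mul u y \<noteq> 0" "mul u (- y) \<noteq> 0"
  shows "lip_diff mul \<alpha> K (dil \<nu> r u) (dil \<nu> r y) = of_real (r powr s) * lip_diff mul \<alpha> K u y"
proof -
  have "K (mul (dil \<nu> r u) (dil \<nu> r z)) = of_real (r powr s) * K (mul u z)" if "mul u z \<noteq> 0" for z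
    using hom[OF r that] r by (simp add: dil_mul)
  from this[OF nz(2)] this[OF nz(3)] show ?thesis
    using hom[OF r nz(1)] by (simp add: lip_diff_def algebra_simps)
qed

text \<open>Dilating by \<open>1 / N u\<close> moves \<open>u\<close> to the unit sphere and
  \<open>y\<close> to a point \<open>y'\<close> with \<open>norm y' \<le> B * N u powr - s\<close>.
  The local bound raises this to the power \<open>diff_order \<alpha>\<close>, and homogeneity of
  the kernel restores \<open>N u powr \<mu>\<close>.\<close>

lemma lip_diff_far_le:
  assumes K: "smooth_on (- {0}) K"
    and hom: "\<And>r x. 0 < r \<Longrightarrow> x \<noteq> 0 \<Longrightarrow> K (dil \<nu> r x) = of_real (r powr \<mu>) * K x"
    and s: "0 < s" "\<And>i. s \<le> \<nu> i"
  shows "\<exists>R\<ge>1. \<exists>C\<ge>0. \<forall>u y. N y = 1 \<longrightarrow> R \<le> N u \<longrightarrow>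
    norm (lip_diff mul \<alpha> K u y) \<le> C * N u powr (\<mu> - real (diff_order \<alpha>) * s)"
proof -
  obtain d C where d: "0 < d" and C: "0 \<le> C" and near: "\<And>u z. N u = 1 \<Longrightarrow> norm z \<le> d \<Longrightarrow>
      mul u z \<noteq> 0 \<and> norm (lip_diff mul \<alpha> K u z) \<le> C * norm z ^ diff_order \<alpha>"
    using lip_diff_near_unit_sphere_le[OF K] by blast
  obtain B where B: "0 \<le> B" "\<And>z. N z \<le> 1 \<Longrightarrow> norm z \<le> B * N z powr s"
    using norm_le_N_powr[OF s(2)] by blast
  \<comment> \<open>The first entry ensures \<open>N y' \<le> 1\<close>, the second
    \<open>B * r powr - s \<le> d\<close> for \<open>r \<ge> R\<close>, so that the local bound
    applies to \<open>y'\<close>.\<close>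
  define R where "R = max 1 ((B / d) powr (1 / s))"
  let ?k = "diff_order \<alpha>"
  have "norm (lip_diff mul \<alpha> K u y) \<le> (C * B ^ ?k) * N u powr (\<mu> - real ?k * s)"
    if y: "N y = 1" and u: "R \<le> N u" for u y
  proof -
    define r where "r = N u"
    have r: "1 \<le> r" "0 < r" "(B / d) powr (1 / s) \<le> r"
      using u by (auto simp: r_def R_def)
    define u' y' where "u' = dil \<nu> (1 / r) u" and "y' = dil \<nu> (1 / r) y"
    have uy: "u = dil \<nu> r u'" "y = dil \<nu> r y'"
      using r by (auto simp: u'_def y'_def)
    have u': "N u' = 1" and y': "N y' = 1 / r"
      using r y by (auto simp: u'_def y'_def N_dil) (simp add: r_def)
    have ny: "norm y' \<le> B * r powr - s"
      using B(2)[of y'] y' r by (simp add: powr_divide powr_minus_divide)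
    have "B / d = ((B / d) powr (1 / s)) powr s"
      using s B d by (simp add: powr_powr)
    also have "\<dots> \<le> r powr s"
      using r s by (intro powr_mono2) auto
    finally have "B * r powr - s \<le> d"
      using d r by (simp add: powr_minus field_simps)
    then have yd: "norm y' \<le> d" "norm (- y') \<le> d"
      using ny by auto
    have "lip_diff mul \<alpha> K u y = of_real (r powr \<mu>) * lip_diff mul \<alpha> K u' y'"
      unfolding uy using near[OF u' yd(1)] near[OF u' yd(2)] u' r
      by (intro lip_diff_dil hom) auto
    then have "norm (lip_diff mul \<alpha> K u y) = r powr \<mu> * norm (lip_diff mul \<alpha> K u' y')"
      by (simp add: norm_mult)
    also have "\<dots> \<le> r powr \<mu> * (C * (B * r powr - s) ^ ?k)"
      using near[OF u' yd(1)] ny C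
      by (intro mult_left_mono order_trans[OF conjunct2[OF near[OF u' yd(1)]]] power_mono) auto
    also have "(B * r powr - s) ^ ?k = B ^ ?k * r powr (- (real ?k * s))"
      using r by (simp add: power_mult_distrib powr_powr mult.commute flip: powr_realpow)
    also have "r powr \<mu> * (C * (B ^ ?k * r powr (- (real ?k * s)))) = (C * B ^ ?k) * r powr (\<mu> - real ?k * s)"
      by (simp add: powr_diff powr_minus field_simps)
    finally show ?thesis
      by (simp add: r_def)
  qed
  moreover have "1 \<le> R" "0 \<le> C * B ^ ?k"
    using C B by (auto simp: R_def)
  ultimately show ?thesis
    by blast
qed

end

section \<open>Integral bounds\<close>

text \<open>The weights 1, 1 and 2 add up to 4, and the power of the maximum is one of the powers on
  the right.\<close>

lemma powr_sum4_le:
  fixes a b c :: real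
  assumes "0 \<le> a" "0 \<le> b" "0 \<le> c" "0 \<le> q"
  shows "(a + b + 2 * c) powr q \<le> 4 powr q * (a powr q + b powr q + c powr q)"
proof -
  define m where "m = max a (max b c)"
  have "(a + b + 2 * c) powr q \<le> (4 * m) powr q"
    using assms by (intro powr_mono2) (auto simp: m_def)
  also have "\<dots> = 4 powr q * m powr q"
    using assms by (simp add: powr_mult m_def)
  also have "m powr q \<le> a powr q + b powr q + c powr q"
    by (auto simp: m_def max_def)
  finally show ?thesis
    by simp
qed

context quasi_normed_group
begin

lemma homogeneous_bound:
  fixes K :: "real ^ 'n \<Rightarrow> complex"
  assumes K: "continuous_on (- {0}) K"
    and hom: "\<And>r x. 0 < r \<Longrightarrow> x \<noteq> 0 \<Longrightarrow> K (dil \<nu> r x) = of_real (r powr \<mu>) * K x"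
  shows "\<exists>C\<ge>0. \<forall>x. x \<noteq> 0 \<longrightarrow> norm (K x) \<le> C * N x powr \<mu>"
proof -
  have "closed {u. N u = 1}"
    by (intro closed_Collect_eq continuous_intros)
  moreover have "{u. N u = 1} = {u. N u \<le> 1} \<inter> {u. N u = 1}"
    by auto
  ultimately have "compact {u. N u = 1}"
    using compact_Int_closed[OF compact_N_le[of 1]] by metis
  then have "compact (K ` {u. N u = 1})"
    by (intro compact_continuous_image continuous_on_subset[OF K]) auto
  then obtain C where C: "\<And>u. N u = 1 \<Longrightarrow> norm (K u) \<le> C"
    using compact_imp_bounded[of "K ` {u. N u = 1}"] by (auto simp: bounded_iff)
  have "norm (K x) \<le> \<bar>C\<bar> * N x powr \<mu>" if "x \<noteq> 0" for x
  proof -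
    define u where "u = dil \<nu> (1 / N x) x"
    have r: "0 < N x"
      using that by simp
    have u: "N u = 1" "u \<noteq> 0" "x = dil \<nu> (N x) u"
      using r that by (auto simp: u_def N_dil)
    have "norm (K x) = N x powr \<mu> * norm (K u)"
      by (subst u(3)) (use hom[OF r u(2)] in \<open>simp add: norm_mult\<close>)
    also have "\<dots> \<le> N x powr \<mu> * \<bar>C\<bar>"
      using C[OF u(1)] by (intro mult_left_mono) auto
    finally show ?thesis
      by (simp add: mult.commute)
  qed
  then show ?thesis
    by (intro exI[of _ "\<bar>C\<bar>"]) auto
qed

lemma nn_integral_translate:
  fixes g :: "real ^ 'n \<Rightarrow> ennreal"
  assumes "g \<in> borel_measurable borel"
  shows "(\<integral>\<^sup>+u. g (mul u y) \<partial>lborel) = (\<integral>\<^sup>+u. g u \<partial>lborel)"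
proof -
  have "(\<integral>\<^sup>+u. g (mul u y) \<partial>lborel) = (\<integral>\<^sup>+u. g u \<partial>distr lborel borel (\<lambda>u. mul u y))"
    using assms by (subst nn_integral_distr) auto
  then show ?thesis
    by (simp add: distr_lborel_mul)
qed

lemma measurable_lip_diff:
  assumes [measurable]: "K \<in> borel_measurable borel"
  shows "(\<lambda>u. lip_diff mul \<alpha> K u y) \<in> borel_measurable borel"
  unfolding lip_diff_def by (cases "\<alpha> = 1") simp_all

text \<open>The two conditions on \<open>q\<close> are integrability in the two regimes: at the
  singularities of the three terms when \<open>u\<close> is bounded, and at infinity under the decay
  from \<open>lip_diff_far_le\<close>.\<close>

lemma lip_diff_integral_unit_finite:
  assumes K: "smooth_on (- {0}) K"
    and hom: "\<And>r x. 0 < r \<Longrightarrow> x \<noteq> 0 \<Longrightarrow> K (dil \<nu> r x) = of_real (r powr \<mu>) * K x"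
    and s: "0 < s" "\<And>i. s \<le> \<nu> i"
    and q: "1 \<le> q" "0 < \<mu> * q + Q" "(\<mu> - real (diff_order \<alpha>) * s) * q + Q < 0"
  shows "\<exists>B<\<infinity>. \<forall>y. N y = 1 \<longrightarrow> (\<integral>\<^sup>+u. ennreal (norm (lip_diff mul \<alpha> K u y) powr q) \<partial>lborel) \<le> B"
proof -
  have [measurable]: "K \<in> borel_measurable borel"
    by (rule measurable_smooth_off_origin[OF K])
  have cont: "continuous_on (- {0}) K"
    using smooth_on_continuous[OF K, of "[]"] by simp
  let ?\<kappa> = "\<mu> - real (diff_order \<alpha>) * s"
  obtain R C where R: "1 \<le> R" and C: "0 \<le> C" and far: "\<And>u y. N y = 1 \<Longrightarrow> R \<le> N u \<Longrightarrow>
      norm (lip_diff mul \<alpha> K u y) \<le> C * N u powr ?\<kappa>"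
    using lip_diff_far_le[OF K hom s] by blast
  obtain CK where CK: "0 \<le> CK" "\<And>x. x \<noteq> 0 \<Longrightarrow> norm (K x) \<le> CK * N x powr \<mu>"
    using homogeneous_bound[OF cont hom] by blast
  \<comment> \<open>Continuity on a product of compact sets bounds \<open>N (mul u z)\<close>, in
    the role of a quasi-triangle inequality.\<close>
  have "compact ((\<lambda>(u, z). N (mul u z)) ` ({u. N u \<le> R} \<times> {z. N z \<le> 1}))"
    by (intro compact_continuous_image compact_Times compact_N_le)
       (auto intro!: continuous_intros simp: case_prod_unfold)
  then obtain R0 where "\<forall>x\<in>(\<lambda>(u, z). N (mul u z)) ` ({u. N u \<le> R} \<times> {z. N z \<le> 1}). norm x \<le> R0"
    using compact_imp_bounded bounded_iff by metis
  then have R0: "N (mul u z) \<le> R0" if "N u \<le> R" "N z \<le> 1" for u z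
    using that by force
  define R' where "R' = max 1 R0"
  define g where "g u = ennreal (norm (K u) powr q) * indicator {u. N u \<le> R'} u" for u
  define f where "f u = ennreal (N u powr (?\<kappa> * q)) * indicator {u. R \<le> N u} u" for u
  have [measurable]: "g \<in> borel_measurable borel" "f \<in> borel_measurable borel"
    unfolding g_def f_def by measurable
  have "(\<integral>\<^sup>+u. g u \<partial>lborel)
      \<le> (\<integral>\<^sup>+u. ennreal (CK powr q) * (ennreal (N u powr (\<mu> * q)) * indicator {u. N u \<le> R'} u) \<partial>lborel)"
  proof (rule nn_integral_mono_AE)
    \<comment> \<open>\<open>K 0\<close> is arbitrary, so the homogeneous bound holds off the origin
      only.\<close>
    have "AE u in lborel. (u :: real ^ 'n) \<noteq> 0"
      by (rule AE_lborel_singleton)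
    then show "AE u in lborel. g u \<le> ennreal (CK powr q) * (ennreal (N u powr (\<mu> * q)) * indicator {u. N u \<le> R'} u)"
    proof eventually_elim
      case (elim u)
      have "norm (K u) powr q \<le> (CK * N u powr \<mu>) powr q"
        using CK(2)[OF elim] q by (intro powr_mono2) auto
      also have "\<dots> = CK powr q * N u powr (\<mu> * q)"
        using CK(1) by (simp add: powr_mult powr_powr)
      finally show ?case
        by (auto simp: g_def indicator_def ennreal_mult[symmetric] intro!: ennreal_leI)
    qed
  qed
  also have "\<dots> = ennreal (CK powr q) * (\<integral>\<^sup>+u. ennreal (N u powr (\<mu> * q)) * indicator {u. N u \<le> R'} u \<partial>lborel)"
    by (rule nn_integral_cmult) measurable
  also have "\<dots> < \<infinity>"
    using nn_integral_N_powr_near[of "\<mu> * q" R'] q by (auto simp: ennreal_mult_less_top R'_def)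
  finally have g_fin: "(\<integral>\<^sup>+u. g u \<partial>lborel) < \<infinity>" .
  have f_fin: "(\<integral>\<^sup>+u. f u \<partial>lborel) < \<infinity>"
    unfolding f_def using nn_integral_N_powr_far[of "?\<kappa> * q" R] q R by simp
  \<comment> \<open>One integral of \<open>g\<close> for each evaluation point
    \<open>mul u y\<close>, \<open>mul u (- y)\<close> and \<open>u\<close>. By translation
    invariance all three agree, which makes \<open>B\<close> independent of
    \<open>y\<close>.\<close>
  define B where "B = ennreal (4 powr q) * ((\<integral>\<^sup>+u. g u \<partial>lborel) + (\<integral>\<^sup>+u. g u \<partial>lborel) + (\<integral>\<^sup>+u. g u \<partial>lborel)) + ennreal (C powr q) * (\<integral>\<^sup>+u. f u \<partial>lborel)"
  have "(\<integral>\<^sup>+u. ennreal (norm (lip_diff mul \<alpha> K u y) powr q) \<partial>lborel) \<le> B" if y: "N y = 1" for y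
  proof -
    have "ennreal (norm (lip_diff mul \<alpha> K u y) powr q)
        \<le> ennreal (4 powr q) * (g (mul u y) + g (mul u (- y)) + g u) + ennreal (C powr q) * f u" for u
    proof (cases "R \<le> N u")
      case True
      have "norm (lip_diff mul \<alpha> K u y) powr q \<le> (C * N u powr ?\<kappa>) powr q"
        using far[OF y True] q by (intro powr_mono2) auto
      also have "\<dots> = C powr q * N u powr (?\<kappa> * q)"
        using C by (simp add: powr_mult powr_powr)
      finally have "ennreal (norm (lip_diff mul \<alpha> K u y) powr q) \<le> ennreal (C powr q) * f u"
        using True by (simp add: f_def ennreal_mult[symmetric] ennreal_leI)
      then show ?thesis
        by (simp add: add_increasing)
    next
      case False
      then have u: "N u \<le> R"
        by simp
      have R': "N (mul u y) \<le> R'" "N (mul u (- y)) \<le> R'" "N u \<le> R'"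
        using R0[OF u, of y] R0[OF u, of "- y"] R0[OF u, of 0] y by (auto simp: R'_def)
      have "norm (lip_diff mul \<alpha> K u y) \<le> norm (K (mul u y)) + norm (K (mul u (- y))) + 2 * norm (K u)"
      proof (cases "\<alpha> = 1")
        case True
        have "norm (K (mul u y) + K (mul u (- y)) - 2 * K u)
            \<le> norm (K (mul u y)) + norm (K (mul u (- y))) + norm (2 * K u)"
          using norm_triangle_ineq4 norm_triangle_ineq by (meson add_right_mono order_trans)
        then show ?thesis
          using True by (simp add: lip_diff_def norm_mult)
      next
        case False
        have "norm (K (mul u y) - K u) \<le> norm (K (mul u y)) + norm (K u)"
          by (rule norm_triangle_ineq4)
        also have "\<dots> \<le> norm (K (mul u y)) + norm (K (mul u (- y))) + 2 * norm (K u)"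
          by simp
        finally show ?thesis
          using False by (simp add: lip_diff_def)
      qed
      then have "norm (lip_diff mul \<alpha> K u y) powr q
          \<le> (norm (K (mul u y)) + norm (K (mul u (- y))) + 2 * norm (K u)) powr q"
        using q by (intro powr_mono2) auto
      also have "\<dots> \<le> 4 powr q * (norm (K (mul u y)) powr q + norm (K (mul u (- y))) powr q + norm (K u) powr q)"
        using q by (intro powr_sum4_le) auto
      finally have "ennreal (norm (lip_diff mul \<alpha> K u y) powr q)
          \<le> ennreal (4 powr q) * (g (mul u y) + g (mul u (- y)) + g u)"
        using R' by (simp add: g_def ennreal_mult[symmetric] ennreal_leI flip: ennreal_plus)
      then show ?thesis
        by (simp add: add_increasing2)
    qed
    then have "(\<integral>\<^sup>+u. ennreal (norm (lip_diff mul \<alpha> K u y) powr q) \<partial>lborel)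
        \<le> (\<integral>\<^sup>+u. ennreal (4 powr q) * (g (mul u y) + g (mul u (- y)) + g u) + ennreal (C powr q) * f u \<partial>lborel)"
      by (intro nn_integral_mono)
    also have "\<dots> = ennreal (4 powr q) * ((\<integral>\<^sup>+u. g (mul u y) \<partial>lborel) + (\<integral>\<^sup>+u. g (mul u (- y)) \<partial>lborel)
        + (\<integral>\<^sup>+u. g u \<partial>lborel)) + ennreal (C powr q) * (\<integral>\<^sup>+u. f u \<partial>lborel)"
      by (simp add: nn_integral_add nn_integral_cmult)
    also have "\<dots> = B"
      by (simp add: nn_integral_translate B_def)
    finally show ?thesis .
  qed
  moreover have "B < \<infinity>"
    using g_fin f_fin by (auto simp: B_def ennreal_mult_less_top)
  ultimately show ?thesis
    by blast
qed

text \<open>Substituting \<open>dil \<nu> r u\<close> for \<open>u\<close> contributes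
  \<open>r powr Q\<close>, and homogeneity of the kernel contributes
  \<open>r powr (\<mu> * q)\<close>.\<close>

lemma lip_diff_integral_scale:
  assumes K: "K \<in> borel_measurable borel"
    and hom: "\<And>r x. 0 < r \<Longrightarrow> x \<noteq> 0 \<Longrightarrow> K (dil \<nu> r x) = of_real (r powr \<mu>) * K x"
    and r: "0 < r"
  shows "(\<integral>\<^sup>+u. ennreal (norm (lip_diff mul \<alpha> K u (dil \<nu> r y)) powr q) \<partial>lborel)
    = ennreal (r powr (\<mu> * q + Q)) * (\<integral>\<^sup>+u. ennreal (norm (lip_diff mul \<alpha> K u y) powr q) \<partial>lborel)"
proof -
  define \<Phi> where "\<Phi> y u = ennreal (norm (lip_diff mul \<alpha> K u y) powr q)" for y u
  have [measurable]: "\<Phi> y \<in> borel_measurable borel" for y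
    unfolding \<Phi>_def using measurable_lip_diff[OF K] by measurable
  have "(\<integral>\<^sup>+u. \<Phi> (dil \<nu> r y) (dil \<nu> r u) \<partial>lborel) = (\<integral>\<^sup>+u. ennreal (r powr (\<mu> * q)) * \<Phi> y u \<partial>lborel)"
  proof (rule nn_integral_cong_AE)
    \<comment> \<open>The excluded points are those where \<open>u\<close>, \<open>mul u y\<close>
      or \<open>mul u (- y)\<close> is the origin.\<close>
    have "AE u in lborel. u \<noteq> 0" "AE u in lborel. u \<noteq> - y" "AE u in lborel. u \<noteq> y"
      by (rule AE_lborel_singleton)+
    then show "AE u in lborel. \<Phi> (dil \<nu> r y) (dil \<nu> r u) = ennreal (r powr (\<mu> * q)) * \<Phi> y u"
    proof eventually_elim
      case (elim u)
      then have "lip_diff mul \<alpha> K (dil \<nu> r u) (dil \<nu> r y) = of_real (r powr \<mu>) * lip_diff mul \<alpha> K u y"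
        using r by (intro lip_diff_dil hom) (auto simp: mul_eq_0_iff)
      then show ?case
        using r by (simp add: \<Phi>_def norm_mult powr_mult powr_powr ennreal_mult)
    qed
  qed
  then have "ennreal (r powr - Q) * (\<integral>\<^sup>+u. \<Phi> (dil \<nu> r y) u \<partial>lborel) = ennreal (r powr (\<mu> * q)) * (\<integral>\<^sup>+u. \<Phi> y u \<partial>lborel)"
    by (simp add: nn_integral_dil[OF r] nn_integral_cmult)
  then have "ennreal (r powr Q) * (ennreal (r powr - Q) * (\<integral>\<^sup>+u. \<Phi> (dil \<nu> r y) u \<partial>lborel))
      = ennreal (r powr Q) * (ennreal (r powr (\<mu> * q)) * (\<integral>\<^sup>+u. \<Phi> y u \<partial>lborel))"
    by simp
  then show ?thesis
    using r by (simp add: \<Phi>_def mult.assoc[symmetric] ennreal_mult[symmetric] powr_add[symmetric] add.commute)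
qed

lemma lip_diff_integral_le:
  assumes K: "smooth_on (- {0}) K"
    and hom: "\<And>r x. 0 < r \<Longrightarrow> x \<noteq> 0 \<Longrightarrow> K (dil \<nu> r x) = of_real (r powr \<mu>) * K x"
    and s: "0 < s" "\<And>i. s \<le> \<nu> i"
    and q: "1 \<le> q" "0 < \<mu> * q + Q" "(\<mu> - real (diff_order \<alpha>) * s) * q + Q < 0"
  shows "\<exists>B\<ge>0. \<forall>y. (\<integral>\<^sup>+u. ennreal (norm (lip_diff mul \<alpha> K u y) powr q) \<partial>lborel)
    \<le> ennreal (B * N y powr (\<mu> * q + Q))"
proof -
  obtain B where B: "B < \<infinity>"
    "\<And>y. N y = 1 \<Longrightarrow> (\<integral>\<^sup>+u. ennreal (norm (lip_diff mul \<alpha> K u y) powr q) \<partial>lborel) \<le> B"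
    using lip_diff_integral_unit_finite[OF K hom s q] by blast
  obtain b where b: "0 \<le> b" "B = ennreal b"
    using B(1) by (cases B) auto
  have "(\<integral>\<^sup>+u. ennreal (norm (lip_diff mul \<alpha> K u y) powr q) \<partial>lborel) \<le> ennreal (b * N y powr (\<mu> * q + Q))" for y
  proof (cases "y = 0")
    case True
    then have "lip_diff mul \<alpha> K u y = 0" for u
      by (simp add: lip_diff_def)
    then show ?thesis
      by simp
  next
    case False
    then have r: "0 < N y"
      by simp
    define z where "z = dil \<nu> (1 / N y) y"
    have z: "N z = 1" "y = dil \<nu> (N y) z"
      using r by (auto simp: z_def N_dil)
    have "(\<integral>\<^sup>+u. ennreal (norm (lip_diff mul \<alpha> K u (dil \<nu> (N y) z)) powr q) \<partial>lborel)
        = ennreal (N y powr (\<mu> * q + Q)) * (\<integral>\<^sup>+u. ennreal (norm (lip_diff mul \<alpha> K u z) powr q) \<partial>lborel)"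
      by (intro lip_diff_integral_scale measurable_smooth_off_origin[OF K] hom r)
    also have "\<dots> \<le> ennreal (N y powr (\<mu> * q + Q)) * B"
      by (intro mult_left_mono B(2) z(1)) simp
    finally show ?thesis
      using z(2) b by (simp add: ennreal_mult mult.commute)
  qed
  then show ?thesis
    using b(1) by blast
qed

end

section \<open>Hoelder's inequality\<close>

text \<open>Young's inequality for \<open>f x / A\<close> and \<open>g x / B\<close>, integrated. If
  \<open>A\<close> or \<open>B\<close> is 0 this division is meaningless, but then the corresponding
  function vanishes almost everywhere.\<close>

lemma nn_integral_Hoelder:
  fixes f g :: "'a \<Rightarrow> real"
  assumes [measurable]: "f \<in> borel_measurable M" "g \<in> borel_measurable M"
    and pq: "1 < p" "1 < q" "1 / p + 1 / q = 1" and nonneg: "\<And>x. 0 \<le> f x" "\<And>x. 0 \<le> g x"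
    and AB: "0 \<le> A" "0 \<le> B"
    and f: "(\<integral>\<^sup>+x. ennreal (f x powr p) \<partial>M) \<le> ennreal (A powr p)"
    and g: "(\<integral>\<^sup>+x. ennreal (g x powr q) \<partial>M) \<le> ennreal (B powr q)"
  shows "(\<integral>\<^sup>+x. ennreal (f x * g x) \<partial>M) \<le> ennreal (A * B)"
proof -
  have AE_0: "AE x in M. h x = 0"
    if [measurable]: "h \<in> borel_measurable M" and "(\<integral>\<^sup>+x. ennreal (h x powr r) \<partial>M) \<le> 0" for h :: "'a \<Rightarrow> real" and r
  proof -
    have "AE x in M. ennreal (h x powr r) = 0"
      using that(2) by (subst nn_integral_0_iff_AE[symmetric]) auto
    then show ?thesis
      by eventually_elim (simp add: ennreal_eq_0_iff powr_def split: if_splits)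
  qed
  consider "A = 0" | "B = 0" | "0 < A" "0 < B"
    using AB by linarith
  then show ?thesis
  proof cases
    case 1
    then have "AE x in M. f x = 0"
      using f AE_0[of f p] by simp
    then have "(\<integral>\<^sup>+x. ennreal (f x * g x) \<partial>M) = (\<integral>\<^sup>+x. 0 \<partial>M)"
      by (intro nn_integral_cong_AE) (auto elim: eventually_mono)
    then show ?thesis
      by simp
  next
    case 2
    then have "AE x in M. g x = 0"
      using g AE_0[of g q] by simp
    then have "(\<integral>\<^sup>+x. ennreal (f x * g x) \<partial>M) = (\<integral>\<^sup>+x. 0 \<partial>M)"
      by (intro nn_integral_cong_AE) (auto elim: eventually_mono)
    then show ?thesis
      by simp
  next
    case 3
    \<comment> \<open>The coefficients of Young's inequality after multiplication by
      \<open>A * B\<close>, chosen so that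
      \<open>a * A powr p + b * B powr q = A * B * (1 / p + 1 / q)\<close>.\<close>
    define a b where "a = A * B / (p * A powr p)" and "b = A * B / (q * B powr q)"
    have ab: "0 \<le> a" "0 \<le> b"
      using 3 pq by (auto simp: a_def b_def)
    have "f x * g x \<le> a * f x powr p + b * g x powr q" for x
    proof -
      have "f x / A * (g x / B) \<le> (f x / A) powr p / p + (g x / B) powr q / q"
        using pq 3 nonneg by (intro Youngs_inequality) auto
      then have "A * B * (f x / A * (g x / B)) \<le> A * B * ((f x / A) powr p / p + (g x / B) powr q / q)"
        using 3 by (intro mult_left_mono) auto
      then show ?thesis
        using 3 nonneg by (simp add: a_def b_def powr_divide field_simps)
    qed
    then have "(\<integral>\<^sup>+x. ennreal (f x * g x) \<partial>M)
        \<le> (\<integral>\<^sup>+x. ennreal a * ennreal (f x powr p) + ennreal b * ennreal (g x powr q) \<partial>M)"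
      using ab by (intro nn_integral_mono) (simp add: ennreal_mult[symmetric] ennreal_leI flip: ennreal_plus)
    also have "\<dots> = ennreal a * (\<integral>\<^sup>+x. ennreal (f x powr p) \<partial>M) + ennreal b * (\<integral>\<^sup>+x. ennreal (g x powr q) \<partial>M)"
      by (simp add: nn_integral_add nn_integral_cmult)
    also have "\<dots> \<le> ennreal a * ennreal (A powr p) + ennreal b * ennreal (B powr q)"
      using f g by (intro add_mono mult_left_mono) auto
    also have "\<dots> = ennreal (a * A powr p + b * B powr q)"
      using ab by (simp add: ennreal_mult)
    also have "a * A powr p + b * B powr q = A * B * (1 / p + 1 / q)"
      using 3 by (simp add: a_def b_def distrib_left)
    finally show ?thesis
      by (simp add: pq(3))
  qed
qed

lemma Lp_norm_nonneg: "0 \<le> Lp_norm p f"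
  by (simp add: Lp_norm_def)

lemma in_Lp_nn_integral_mult_le:
  fixes f :: "'a::euclidean_space \<Rightarrow> complex" and g :: "'a \<Rightarrow> real"
  assumes f: "in_Lp p f" and p: "1 < p" and q: "1 \<le> q" "ereal (1 / q) = 1 - 1 / p"
    and g: "g \<in> borel_measurable lebesgue" "\<And>x. 0 \<le> g x"
    and B: "0 \<le> B" "(\<integral>\<^sup>+x. ennreal (g x powr q) \<partial>lebesgue) \<le> ennreal (B powr q)"
  shows "(\<integral>\<^sup>+x. ennreal (norm (f x) * g x) \<partial>lebesgue) \<le> ennreal (Lp_norm p f * B)"
proof (cases "p = \<infinity>")
  case True
  \<comment> \<open>In \<open>ereal\<close> the quotient \<open>1 / p\<close> is 0 for infinite
    \<open>p\<close>, so the conjugate exponent is 1 and the essential supremum can be pulled out of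
    the integral.\<close>
  then have q1: "q = 1"
    using q by (simp add: one_ereal_def)
  have fin: "esssup lebesgue (\<lambda>x. ennreal (norm (f x))) < \<infinity>"
    using f True by (simp add: in_Lp_def)
  have L: "ennreal (Lp_norm p f) = esssup lebesgue (\<lambda>x. ennreal (norm (f x)))"
    using fin True by (simp add: Lp_norm_def)
  have "(\<integral>\<^sup>+x. ennreal (norm (f x) * g x) \<partial>lebesgue)
      \<le> (\<integral>\<^sup>+x. ennreal (Lp_norm p f) * ennreal (g x powr q) \<partial>lebesgue)"
  proof (rule nn_integral_mono_AE)
    show "AE x in lebesgue. ennreal (norm (f x) * g x) \<le> ennreal (Lp_norm p f) * ennreal (g x powr q)"
      using esssup_AE[of "\<lambda>x. ennreal (norm (f x))" lebesgue]
      by eventually_elim (use g(2) in \<open>simp add: L ennreal_mult q1 mult_right_mono\<close>)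
  qed
  also have "\<dots> = ennreal (Lp_norm p f) * (\<integral>\<^sup>+x. ennreal (g x powr q) \<partial>lebesgue)"
    using g by (intro nn_integral_cmult) simp
  also have "\<dots> \<le> ennreal (Lp_norm p f) * ennreal (B powr q)"
    using B by (intro mult_left_mono) auto
  also have "\<dots> = ennreal (Lp_norm p f * B)"
    using B(1) by (simp add: q1 ennreal_mult Lp_norm_nonneg)
  finally show ?thesis .
next
  case False
  then obtain P where P: "p = ereal P" "1 < P"
    using p by (cases p) auto
  have pq: "1 / P + 1 / q = 1"
    using q(2) P by (simp add: one_ereal_def)
  then have "1 < q"
    using q(1) P(2) by (cases "q = 1") auto
  have int: "integrable lebesgue (\<lambda>x. norm (f x) powr P)" and fm: "f \<in> borel_measurable lebesgue"
    using f False by (auto simp: in_Lp_def P)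
  have "(LINT x|lebesgue. norm (f x) powr P) = Lp_norm p f powr P"
    using P by (simp add: Lp_norm_def powr_powr integral_nonneg)
  then have "(\<integral>\<^sup>+x. ennreal (norm (f x) powr P) \<partial>lebesgue) = ennreal (Lp_norm p f powr P)"
    using nn_integral_eq_integral[OF int] by simp
  then show ?thesis
    using P \<open>1 < q\<close> pq g B fm by (intro nn_integral_Hoelder[of _ _ _ P q]) (auto simp: Lp_norm_nonneg)
qed

section \<open>Convolution\<close>

context homogeneous_group
begin

text \<open>With \<open>z = w^-1 x\<close> one has \<open>x z^-1 = w\<close>, so \<open>x\<close>
  moves from \<open>f\<close> into the smooth factor, where differences can be estimated.\<close>

lemma conv_substitution:
  assumes "conv_integrable mul f K x"
  shows "integrable lebesgue (\<lambda>w. f w * K (mul (- w) x))"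
    and "conv mul f K x = (LINT w|lebesgue. f w * K (mul (- w) x))"
proof -
  define T where "T w = mul (- w) x" for w
  define F where "F z = f (mul x (- z)) * K z" for z
  have Tm: "T \<in> borel_measurable borel"
    unfolding T_def by measurable
  have "distr lborel borel T = lborel"
    unfolding T_def[abs_def] by (rule distr_lborel_minus_mul)
  note T = lebesgue_distr_measurable[OF Tm this] lebesgue_distr_eq[OF Tm this]
  have F: "integrable lebesgue F"
    using assms by (simp add: conv_integrable_def F_def[abs_def])
  have FT: "F (T w) = f w * K (mul (- w) x)" for w
    by (simp add: F_def T_def minus_mul)
  have "integrable (distr lebesgue lebesgue T) F"
    using F T(2) by simp
  then show "integrable lebesgue (\<lambda>w. f w * K (mul (- w) x))"
    using integrable_distr[OF T(1), of F] by (simp add: FT)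
  have "conv mul f K x = integral\<^sup>L (distr lebesgue lebesgue T) F"
    by (simp add: conv_def F_def[abs_def] T(2))
  also have "\<dots> = (LINT w|lebesgue. F (T w))"
    using T(1) borel_measurable_integrable[OF F] by (rule integral_distr)
  finally show "conv mul f K x = (LINT w|lebesgue. f w * K (mul (- w) x))"
    by (simp add: FT)
qed

text \<open>Convergence at every point allows the integrals at \<open>mul x y\<close>,
  \<open>mul x (- y)\<close> and \<open>x\<close> to be combined by linearity.\<close>

lemma lip_diff_conv:
  assumes "\<And>x. conv_integrable mul f K x"
  shows "lip_diff mul \<alpha> (conv mul f K) x y = conv_diff mul \<alpha> f K x y"
proof -
  note int = conv_substitution(1)[OF assms]
  note conv = conv_substitution(2)[OF assms]
  show ?thesis
  proof (cases "\<alpha> = 1")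
    case True
    have "conv_diff_integrand mul \<alpha> f K x y w = f w * K (mul (- w) (mul x y))
        + f w * K (mul (- w) (mul x (- y))) - 2 * (f w * K (mul (- w) x))" for w
      using True by (simp add: conv_diff_integrand_def lip_diff_def algebra_simps)
    then show ?thesis
      using True int by (simp add: conv_diff_def lip_diff_def conv)
  next
    case False
    have "conv_diff_integrand mul \<alpha> f K x y w = f w * K (mul (- w) (mul x y)) - f w * K (mul (- w) x)" for w
      using False by (simp add: conv_diff_integrand_def lip_diff_def algebra_simps)
    then show ?thesis
      using False int by (simp add: conv_diff_def lip_diff_def conv)
  qed
qed

end

context quasi_normed_group
begin

section \<open>The estimate for differences of the convolution\<close>

lemma conv_diff_bound:
  assumes K: "kernel_of_type \<nu> lam \<tau> K" and p: "1 < p" and \<alpha>: "0 < \<alpha>"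
    and exponent: "ereal \<alpha> = ereal lam - ereal Q / p" and Q: "lam < Q"
    and adm: "order_admissible \<nu> \<alpha>"
  shows "\<exists>C\<ge>0. \<forall>f. in_Lp p f \<longrightarrow> (\<forall>x y. integrable lebesgue (conv_diff_integrand mul \<alpha> f K x y) \<and>
    norm (conv_diff mul \<alpha> f K x y) \<le> C * Lp_norm p f * N y powr \<alpha>)"
proof -
  have sm: "smooth_on (- {0}) K"
    using K by (simp add: kernel_of_type_def smooth_off_origin_def)
  have [measurable]: "K \<in> borel_measurable borel"
    by (rule measurable_smooth_off_origin[OF sm])
  have hom: "K (dil \<nu> r x) = of_real (r powr (lam - Q)) * K x" if "0 < r" "x \<noteq> 0" for r x
    using kernel_homogeneous[OF K that] .
  have "0 < Q"
    unfolding hom_dim_def using weight_pos by (intro sum_pos) auto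
  \<comment> \<open>The exponent conjugate to \<open>p\<close>: since
    \<open>Q / p = lam - \<alpha>\<close>, one needs
    \<open>1 / q = 1 - (lam - \<alpha>) / Q\<close>. For infinite \<open>p\<close> this gives
    \<open>lam = \<alpha>\<close> and \<open>q = 1\<close>.\<close>
  define q where "q = Q / (Q - lam + \<alpha>)"
  have q_pos: "0 < q"
    using \<open>0 < Q\<close> Q \<alpha> by (simp add: q_def)
  have q_conj: "1 \<le> q \<and> ereal (1 / q) = 1 - 1 / p"
  proof (cases p)
    case (real P)
    have P: "1 < P"
      using p real by simp
    then have "\<alpha> = lam - Q / P"
      using exponent real by simp
    then have inv: "1 / q = 1 - 1 / P"
      using P \<open>0 < Q\<close> by (simp add: q_def field_simps)
    then have "1 / q \<le> 1"
      using P by simp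
    then have "1 \<le> q"
      using q_pos by simp
    then show ?thesis
      using inv real P by (simp add: one_ereal_def)
  next
    case PInf
    then have "\<alpha> = lam"
      using exponent by simp
    then show ?thesis
      using PInf \<open>0 < Q\<close> by (simp add: q_def one_ereal_def)
  qed (use p in simp)
  \<comment> \<open>The scaling exponent of the integral of the q-th power; its q-th root yields
    \<open>N y powr \<alpha>\<close>.\<close>
  have exp_q: "(lam - Q) * q + Q = \<alpha> * q"
    using \<open>0 < Q\<close> Q \<alpha> by (simp add: q_def field_simps)
  define s where "s = Min (range \<nu>)"
  have "s \<in> range \<nu>"
    unfolding s_def by (rule Min_in) auto
  then obtain i where i: "s = \<nu> i"
    by blast
  have s: "0 < s" "\<And>j. s \<le> \<nu> j"
    using weight_pos i Min_le[of "range \<nu>"] by (simp, simp add: s_def)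
  \<comment> \<open>Admissibility, read at the smallest weight; through \<open>exp_q\<close> it
    becomes the integrability condition at infinity.\<close>
  have "\<alpha> < real (diff_order \<alpha>) * s"
    using adm i by (auto simp: order_admissible_def diff_order_def split: if_splits)
  then have "\<alpha> * q < real (diff_order \<alpha>) * s * q"
    using q_pos by (intro mult_strict_right_mono)
  then have far: "(lam - Q - real (diff_order \<alpha>) * s) * q + Q < 0"
    using exp_q by (simp add: algebra_simps)
  have near: "0 < (lam - Q) * q + Q"
    using q_pos \<alpha> by (simp add: exp_q)
  obtain B where B: "0 \<le> B" "\<And>y. (\<integral>\<^sup>+u. ennreal (norm (lip_diff mul \<alpha> K u y) powr q) \<partial>lborel)
      \<le> ennreal (B * N y powr (\<alpha> * q))"
    using lip_diff_integral_le[OF sm hom s conjunct1[OF q_conj] near far] unfolding exp_q by blast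
  define C where "C = B powr (1 / q)"
  have "integrable lebesgue (conv_diff_integrand mul \<alpha> f K x y) \<and>
      norm (conv_diff mul \<alpha> f K x y) \<le> C * Lp_norm p f * N y powr \<alpha>" if f: "in_Lp p f" for f x y
  proof -
    \<comment> \<open>Left invariance of the difference operator makes the integrand
      \<open>f w * h w\<close>, and the q-th power integral of \<open>h\<close> is independent of
      \<open>x\<close> by the substitution \<open>u = w^-1 x\<close>.\<close>
    define h where "h w = lip_diff mul \<alpha> K (mul (- w) x) y" for w
    have h_borel: "h \<in> borel_measurable borel"
      unfolding h_def
      by (rule measurable_compose[OF _ measurable_lip_diff]) measurable
    then have h: "h \<in> borel_measurable lebesgue"
      by (intro measurable_completion) simp
    have fm: "f \<in> borel_measurable lebesgue"
      using f by (simp add: in_Lp_def)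
    have integrand: "conv_diff_integrand mul \<alpha> f K x y = (\<lambda>w. f w * h w)"
      by (simp add: fun_eq_iff conv_diff_integrand_def h_def lip_diff_translate)
    have "(\<integral>\<^sup>+w. ennreal (norm (h w) powr q) \<partial>lebesgue) = (\<integral>\<^sup>+w. ennreal (norm (h w) powr q) \<partial>lborel)"
      by (rule nn_integral_completion)
    also have "\<dots> = (\<integral>\<^sup>+u. ennreal (norm (lip_diff mul \<alpha> K u y) powr q) \<partial>distr lborel borel (\<lambda>w. mul (- w) x))"
      using measurable_lip_diff by (subst nn_integral_distr) (auto simp: h_def)
    also have "\<dots> \<le> ennreal (B * N y powr (\<alpha> * q))"
      unfolding distr_lborel_minus_mul by (rule B(2))
    also have "B * N y powr (\<alpha> * q) = (C * N y powr \<alpha>) powr q"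
      using q_pos B(1) by (simp add: C_def powr_mult powr_powr)
    finally have "(\<integral>\<^sup>+w. ennreal (norm (f w) * norm (h w)) \<partial>lebesgue) \<le> ennreal (Lp_norm p f * (C * N y powr \<alpha>))"
      using h q_conj f p by (intro in_Lp_nn_integral_mult_le[where q = q]) (auto simp: C_def)
    then have bound: "(\<integral>\<^sup>+w. ennreal (norm (f w * h w)) \<partial>lebesgue) \<le> ennreal (C * Lp_norm p f * N y powr \<alpha>)"
      by (simp add: norm_mult mult_ac)
    then have int: "integrable lebesgue (\<lambda>w. f w * h w)"
      using fm h by (intro integrableI_bounded) (auto intro: order_le_less_trans)
    have "ennreal (norm (conv_diff mul \<alpha> f K x y)) \<le> (\<integral>\<^sup>+w. ennreal (norm (f w * h w)) \<partial>lebesgue)"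
      unfolding conv_diff_def integrand by (rule integral_norm_bound_ennreal[OF int])
    then have "ennreal (norm (conv_diff mul \<alpha> f K x y)) \<le> ennreal (C * Lp_norm p f * N y powr \<alpha>)"
      using bound by (rule order_trans)
    then have "norm (conv_diff mul \<alpha> f K x y) \<le> C * Lp_norm p f * N y powr \<alpha>"
      by (simp add: C_def Lp_norm_nonneg)
    with int show ?thesis
      by (simp add: integrand)
  qed
  moreover have "0 \<le> C"
    by (simp add: C_def)
  ultimately show ?thesis
    by blast
qed

lemma lip_sup_leI:
  assumes "0 \<le> c" "\<And>x y. norm (D x y) \<le> c * N y powr \<alpha>"
  shows "lip_sup N \<alpha> D \<le> ennreal c"
  unfolding lip_sup_def
proof (intro SUP_least ennreal_leI)
  fix x y
  show "norm (D x y) / N y powr \<alpha> \<le> c"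
  \<comment> \<open>When the denominator vanishes, the quotient is 0 by the convention on
    division.\<close>
  proof (cases "N y powr \<alpha> = 0")
    case False
    then have "0 < N y powr \<alpha>"
      by (simp add: less_le)
    then show ?thesis
      using assms(2)[of x y] by (simp add: pos_divide_le_eq)
  qed (simp add: assms(1))
qed

end

theorem lemma4p6:
  fixes mul :: "real ^ 'n::finite \<Rightarrow> real ^ 'n \<Rightarrow> real ^ 'n"
    and \<nu> :: "'n \<Rightarrow> real"
    and N :: "real ^ 'n \<Rightarrow> real"
    and lam \<alpha> :: real
    and p :: ereal
    and \<tau> :: "(real ^ 'n \<Rightarrow> complex) \<Rightarrow> complex"
    and K :: "real ^ 'n \<Rightarrow> complex"
  assumes "homogeneous_group mul \<nu>"
    and "homogeneous_quasi_norm \<nu> N"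
    and "0 < lam" "lam < hom_dim \<nu>"
    and "0 < \<alpha>" "\<alpha> \<le> 1"
    and "1 < p"
    and "ereal \<alpha> = ereal lam - ereal (hom_dim \<nu>) / p"
    and "order_admissible \<nu> \<alpha>"
    and "kernel_of_type \<nu> lam \<tau> K"
  shows "\<exists>C::real. 0 \<le> C \<and> (\<forall>f. in_Lp p f \<longrightarrow>
           ((\<forall>x. conv_integrable mul f K x) \<longrightarrow>
              lip_seminorm mul N \<alpha> (conv mul f K) \<le> ennreal (C * Lp_norm p f)) \<and>
           ((\<forall>x y. integrable lebesgue (conv_diff_integrand mul \<alpha> f K x y)) \<and>
              lip_sup N \<alpha> (conv_diff mul \<alpha> f K) \<le> ennreal (C * Lp_norm p f)))"
proof -
  interpret quasi_normed_group mul \<nu> N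
    using assms(1,2) by (simp add: quasi_normed_group_def quasi_normed_group_axioms_def)
  obtain C where C: "0 \<le> C" "\<And>f x y. in_Lp p f \<Longrightarrow> integrable lebesgue (conv_diff_integrand mul \<alpha> f K x y)"
    "\<And>f x y. in_Lp p f \<Longrightarrow> norm (conv_diff mul \<alpha> f K x y) \<le> C * Lp_norm p f * N y powr \<alpha>"
    using conv_diff_bound[OF assms(10,7,5,8,4,9)] by blast
  have "lip_sup N \<alpha> (conv_diff mul \<alpha> f K) \<le> ennreal (C * Lp_norm p f)" if "in_Lp p f" for f
    using C(1) C(3)[OF that] by (intro lip_sup_leI) (auto simp: Lp_norm_nonneg)
  \<comment> \<open>Where the convolution converges everywhere its differences are
    \<open>conv_diff\<close>, so the bound on the seminorm is the one just obtained.\<close>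
  moreover have "lip_seminorm mul N \<alpha> (conv mul f K) = lip_sup N \<alpha> (conv_diff mul \<alpha> f K)"
    if "\<forall>x. conv_integrable mul f K x" for f
  proof -
    have "lip_diff mul \<alpha> (conv mul f K) = conv_diff mul \<alpha> f K"
      using that by (intro ext lip_diff_conv) auto
    then show ?thesis
      by (simp add: lip_seminorm_def)
  qed
  ultimately show ?thesis
    using C(1,2) by (intro exI[of _ C]) auto
qed

end
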